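(* Let $h>0$, $\Omega=\{(x_1,x_2)\in\mathbb{R}^2: 0<x_2<x_1<h\}$ (an isosceles right triangle) and $\Gamma=\{x_1=h,\ x_2\in[0,h]\}\cup\{x_2=0,\ x_1\in[0,h]\}$ (the union of the two legs). Then the sharp constant $C_1(\Omega,\Gamma)$ is equal to $\frac h\pi$.
   Context: For a bounded connected Lipschitz domain $\Omega\subset\mathbb{R}^d$ and a measurable part $\Gamma\subset\partial\Omega$ of positive $(d-1)$-dimensional measure, let $\widetilde H^1(\Omega,\Gamma)=\{w\in H^1(\Omega): \text{the mean value of (the trace of) } w \text{ on } \Gamma \text{ is zero}\}$. The norm in $L^2(\omega)$ is denoted $\|\cdot\|_{2,\omega}$. The sharp constant $C_1(\Omega,\Gamma)$ is the smallest constant $C$ such that $\|w\|_{2,\Omega}\le C\|\nabla w\|_{2,\Omega}$ for all $w\in\widetilde H^1(\Omega,\Gamma)$. *)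

theory Defs
  imports "HOL-Analysis.Analysis"
begin

text \<open>
  The surface measure on the boundary of a domain in a Euclidean space of dimension \<open>d\<close> is the
  \<open>(d - 1)\<close>-dimensional Hausdorff measure.  The factor \<open>unit_ball_vol s\<close> normalises it so that it
  agrees with the usual \<open>s\<close>-dimensional area (for \<open>s = 1\<close>: with arc length, since
  \<open>unit_ball_vol 1 * (diameter C / 2) = diameter C\<close>).  The case distinction on \<open>C = {}\<close> only matters
  for \<open>s = 0\<close>, where \<open>0 ^ 0 = 1\<close>.
\<close>

definition hausdorff_gauge :: "nat \<Rightarrow> 'a::euclidean_space set \<Rightarrow> ennreal" where
  "hausdorff_gauge s C =
     (if C = {} then 0 else ennreal (unit_ball_vol (real s) * (diameter C / 2) ^ s))"

definition hausdorff_content :: "nat \<Rightarrow> real \<Rightarrow> 'a::euclidean_space set \<Rightarrow> ennreal" where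
  "hausdorff_content s \<delta> A =
     (INF C \<in> {C :: nat \<Rightarrow> 'a set.
                 A \<subseteq> (\<Union>n. C n) \<and> (\<forall>n. bounded (C n) \<and> diameter (C n) \<le> \<delta>)}.
        \<Sum>n. hausdorff_gauge s (C n))"

definition hausdorff_outer :: "nat \<Rightarrow> 'a::euclidean_space set \<Rightarrow> ennreal" where
  "hausdorff_outer s A = (SUP \<delta> \<in> {0<..}. hausdorff_content s \<delta> A)"

text \<open>The measurable sets are the Caratheodory measurable ones.\<close>

definition hausdorff_measure :: "nat \<Rightarrow> 'a::euclidean_space measure" where
  "hausdorff_measure s =
     measure_of UNIV (lambda_system UNIV UNIV (hausdorff_outer s)) (hausdorff_outer s)"

abbreviation surface_measure :: "'a::euclidean_space measure" where
  "surface_measure \<equiv> hausdorff_measure (DIM('a) - 1)"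

definition mean_value :: "'a::euclidean_space set \<Rightarrow> ('a \<Rightarrow> real) \<Rightarrow> real" where
  "mean_value \<Gamma> g = (LINT x:\<Gamma>|surface_measure. g x) / measure surface_measure \<Gamma>"

definition L2 :: "'a measure \<Rightarrow> ('a \<Rightarrow> 'b::euclidean_space) set" where
  "L2 M = {f \<in> borel_measurable M. integrable M (\<lambda>x. (norm (f x))\<^sup>2)}"

definition L2_norm :: "'a measure \<Rightarrow> ('a \<Rightarrow> 'b::euclidean_space) \<Rightarrow> real" where
  "L2_norm M f = sqrt (LINT x|M. (norm (f x))\<^sup>2)"

definition L2_tendsto ::
    "'a measure \<Rightarrow> (nat \<Rightarrow> 'a \<Rightarrow> 'b::euclidean_space) \<Rightarrow> ('a \<Rightarrow> 'b) \<Rightarrow> bool" where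
  "L2_tendsto M u f \<longleftrightarrow>
     (\<forall>n. (\<lambda>x. u n x - f x) \<in> L2 M) \<and> (\<lambda>n. L2_norm M (\<lambda>x. u n x - f x)) \<longlonglongrightarrow> 0"

definition partial_deriv :: "'a::euclidean_space \<Rightarrow> ('a \<Rightarrow> real) \<Rightarrow> 'a \<Rightarrow> real" where
  "partial_deriv i f x = frechet_derivative f (at x) i"

definition grad :: "('a::euclidean_space \<Rightarrow> real) \<Rightarrow> 'a \<Rightarrow> 'a" where
  "grad f x = (\<Sum>i\<in>Basis. partial_deriv i f x *\<^sub>R i)"

primrec C_k :: "nat \<Rightarrow> ('a::euclidean_space \<Rightarrow> real) \<Rightarrow> bool" where
  "C_k 0 f \<longleftrightarrow> continuous_on UNIV f"
| "C_k (Suc k) f \<longleftrightarrow>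
     (\<forall>x. f differentiable (at x)) \<and> (\<forall>i\<in>Basis. C_k k (partial_deriv i f))"

definition smooth :: "('a::euclidean_space \<Rightarrow> real) \<Rightarrow> bool" where
  "smooth f \<longleftrightarrow> (\<forall>k. C_k k f)"

definition test_function :: "'a::euclidean_space set \<Rightarrow> ('a \<Rightarrow> real) \<Rightarrow> bool" where
  "test_function \<Omega> \<phi> \<longleftrightarrow>
     smooth \<phi> \<and> compact (closure {x. \<phi> x \<noteq> 0}) \<and> closure {x. \<phi> x \<noteq> 0} \<subseteq> \<Omega>"

definition weak_gradient ::
    "'a::euclidean_space set \<Rightarrow> ('a \<Rightarrow> real) \<Rightarrow> ('a \<Rightarrow> 'a) \<Rightarrow> bool" where
  "weak_gradient \<Omega> w G \<longleftrightarrow>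
     (\<forall>\<phi>. test_function \<Omega> \<phi> \<longrightarrow> (\<forall>i\<in>Basis.
        (LINT x|lebesgue_on \<Omega>. w x * partial_deriv i \<phi> x) =
        - (LINT x|lebesgue_on \<Omega>. (G x \<bullet> i) * \<phi> x)))"

text \<open>
  An element of \<open>H\<^sup>1(\<Omega>)\<close> is represented by a pair \<open>(w, G)\<close> of a function and its weak gradient;
  on an open set \<open>w\<close> determines \<open>G\<close> up to a null set.
\<close>

definition H1 :: "'a::euclidean_space set \<Rightarrow> (('a \<Rightarrow> real) \<times> ('a \<Rightarrow> 'a)) set" where
  "H1 \<Omega> = {(w, G). w \<in> L2 (lebesgue_on \<Omega>) \<and> G \<in> L2 (lebesgue_on \<Omega>) \<and> weak_gradient \<Omega> w G}"

text \<open>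
  The trace operator from \<open>H\<^sup>1(\<Omega>)\<close> to \<open>L\<^sup>2(\<partial>\<Omega>)\<close> of a bounded Lipschitz domain is the continuous
  extension of the restriction map \<open>u \<mapsto> u|\<partial>\<Omega>\<close> from the functions that are smooth up to the
  boundary, which are dense in \<open>H\<^sup>1(\<Omega>)\<close>.  The predicate below is its graph: the closure of the
  graph of the restriction map.
\<close>

definition has_trace ::
    "'a::euclidean_space set \<Rightarrow> ('a \<Rightarrow> real) \<times> ('a \<Rightarrow> 'a) \<Rightarrow> ('a \<Rightarrow> real) \<Rightarrow> bool" where
  "has_trace \<Omega> = (\<lambda>(w, G) g.
     g \<in> L2 (restrict_space surface_measure (frontier \<Omega>)) \<and>
     (\<exists>u. (\<forall>n. smooth (u n)) \<and>
          L2_tendsto (lebesgue_on \<Omega>) u w \<and>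
          L2_tendsto (lebesgue_on \<Omega>) (\<lambda>n. grad (u n)) G \<and>
          L2_tendsto (restrict_space surface_measure (frontier \<Omega>)) u g))"

definition H1_mean_zero ::
    "'a::euclidean_space set \<Rightarrow> 'a set \<Rightarrow> (('a \<Rightarrow> real) \<times> ('a \<Rightarrow> 'a)) set" where
  "H1_mean_zero \<Omega> \<Gamma> = {W \<in> H1 \<Omega>. \<exists>g. has_trace \<Omega> W g \<and> mean_value \<Gamma> g = 0}"

definition poincare_bound :: "'a::euclidean_space set \<Rightarrow> 'a set \<Rightarrow> real \<Rightarrow> bool" where
  "poincare_bound \<Omega> \<Gamma> C \<longleftrightarrow>
     (\<forall>(w, G) \<in> H1_mean_zero \<Omega> \<Gamma>. L2_norm (lebesgue_on \<Omega>) w \<le> C * L2_norm (lebesgue_on \<Omega>) G)"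

definition is_sharp_constant :: "'a::euclidean_space set \<Rightarrow> 'a set \<Rightarrow> real \<Rightarrow> bool" where
  "is_sharp_constant \<Omega> \<Gamma> C \<longleftrightarrow>
     poincare_bound \<Omega> \<Gamma> C \<and> (\<forall>C'. poincare_bound \<Omega> \<Gamma> C' \<longrightarrow> C \<le> C')"

end

theory Submission
  imports Defs
begin

text \<open>
  Reflecting the triangle in its hypotenuse turns a function \<open>u\<close> on it into the symmetric function
  \<open>W (x, y) = u (max x y, min x y)\<close> on the square \<open>[0, h]\<^sup>2\<close>; the integrals of \<open>u\<^sup>2\<close> and of
  \<open>|\<nabla>u|\<^sup>2\<close> are doubled.  Let \<open>f y\<close> be the mean value of \<open>W\<close> on the row at height \<open>y\<close>.  The bottom
  and the top row of the square are copies of the two legs, so \<open>u\<close> has mean value zero on the legs if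
  and only if \<open>f 0 + f h = 0\<close>.  Now \<open>W - f\<close> has mean value zero on every row, hence it is orthogonal
  to \<open>f\<close>, and two one-dimensional inequalities with the same sharp constant \<open>h / \<pi>\<close> apply:
  \<^item> \<open>\<integral> f\<^sup>2 \<le> (h / \<pi>)\<^sup>2 \<integral> f'\<^sup>2\<close> because \<open>f\<close> has opposite values at \<open>0\<close> and \<open>h\<close>
    (\<open>antiperiodic_wirtinger\<close>);
  \<^item> on each row, \<open>\<integral> (W - f)\<^sup>2 \<le> (h / \<pi>)\<^sup>2 \<integral> (\<partial>W/\<partial>x)\<^sup>2\<close> because \<open>W - f\<close> has mean value zero
    (\<open>zero_mean_wirtinger\<close>).

  Since \<open>f'\<close> is the row mean of \<open>\<partial>W/\<partial>y\<close>, Jensen's inequality bounds \<open>h f'\<^sup>2\<close> by the integral of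
  \<open>(\<partial>W/\<partial>y)\<^sup>2\<close> over the row, and adding up gives the inequality with constant \<open>h / \<pi>\<close> for
  continuously differentiable \<open>u\<close> (\<open>triangle_poincare\<close>).  The function
  \<open>cos (\<pi> x / h) + cos (\<pi> y / h)\<close> has mean value zero on the legs and turns it into an equality, so
  that the constant cannot be improved.

  An element of the Sobolev space with mean value zero on the legs is approximated by smooth
  functions together with its trace.  Their mean values on the legs tend to zero, and subtracting
  them costs nothing in the limit (\<open>poincare_bound_right_triangle\<close>).  This requires that the
  one-dimensional Hausdorff measure integrates continuous functions over the legs as arc length does.
  Hausdorff measure is additive on sets at positive distance, so that Borel sets are measurable
  (\<open>borel_subset_hausdorff\<close>), and its restriction to a straight line is Lebesgue measure because it
  has the right value on segments (\<open>distr_hausdorff_line\<close>).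
\<close>

section \<open>Hausdorff measure is a Borel measure\<close>

lemma hausdorff_content_le:
  assumes "A \<subseteq> (\<Union>n. C n)" "\<And>n. bounded (C n)" "\<And>n. diameter (C n) \<le> \<delta>"
  shows "hausdorff_content s \<delta> A \<le> (\<Sum>n. hausdorff_gauge s (C n))"
  unfolding hausdorff_content_def using assms by (intro INF_lower) auto

lemma hausdorff_content_close:
  assumes "hausdorff_content s \<delta> A < e"
  obtains C where "A \<subseteq> (\<Union>n. C n)" "\<And>n. bounded (C n)" "\<And>n. diameter (C n) \<le> \<delta>"
    "(\<Sum>n. hausdorff_gauge s (C n)) < e"
  using assms unfolding hausdorff_content_def INF_less_iff by auto

lemma hausdorff_content_mono:
  assumes "A \<subseteq> B" shows "hausdorff_content s \<delta> A \<le> hausdorff_content s \<delta> B"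
  unfolding hausdorff_content_def using assms by (intro INF_superset_mono) auto

lemma hausdorff_content_antimono:
  assumes "\<delta> \<le> \<delta>'" shows "hausdorff_content s \<delta>' A \<le> hausdorff_content s \<delta> A"
  unfolding hausdorff_content_def using assms by (intro INF_superset_mono) (auto intro: order_trans)

lemma hausdorff_content_empty: "0 \<le> \<delta> \<Longrightarrow> hausdorff_content s \<delta> {} = 0"
  using hausdorff_content_le[of "{}" "\<lambda>_. {}" \<delta> s] by (simp add: hausdorff_gauge_def)

text \<open>
  Covers of the single sets that are optimal up to \<open>e / 2\<^sup>n\<^sup>+\<^sup>1\<close> combine to a cover of the union, as in
  the countable subadditivity of any outer measure that is defined by covers.
\<close>

lemma hausdorff_content_UN_le:
  "hausdorff_content s \<delta> (\<Union>i. A i) \<le> (\<Sum>i. hausdorff_content s \<delta> (A i))"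
proof (rule ennreal_le_epsilon)
  let ?H = "hausdorff_content s \<delta>" and ?g = "hausdorff_gauge s"
  fix e :: real assume "0 < e" "(\<Sum>n. ?H (A n)) < top"
  then have *: "\<And>n. ?H (A n) < ?H (A n) + e * (1/2)^Suc n"
    by (auto simp add: less_top dest!: ennreal_suminf_lessD)
  have "\<exists>C. A n \<subseteq> (\<Union>i. C i) \<and> (\<forall>i. bounded (C i)) \<and> (\<forall>i. diameter (C i) \<le> \<delta>) \<and>
      (\<Sum>i. ?g (C i)) \<le> ?H (A n) + e * (1/2)^Suc n" for n
    by (rule hausdorff_content_close[OF *[of n]]) (metis less_imp_le)
  then obtain B where B: "\<And>n. A n \<subseteq> (\<Union>i. B n i)" "\<And>n i. bounded (B n i)"
      "\<And>n i. diameter (B n i) \<le> \<delta>" "\<And>n. (\<Sum>i. ?g (B n i)) \<le> ?H (A n) + e * (1/2)^Suc n"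
    by metis
  define C where "C = case_prod B o prod_decode"
  have A_C: "(\<Union>i. A i) \<subseteq> (\<Union>i. C i)"
    using B(1) by (auto simp add: C_def subset_eq) (metis prod.case prod_encode_inverse)
  have "?H (\<Union>i. A i) \<le> (\<Sum>i. ?g (C i))"
    by (rule hausdorff_content_le[OF A_C]) (simp_all add: C_def split_beta B)
  also have "\<dots> = (\<Sum>n. \<Sum>i. ?g (B n i))"
    unfolding C_def comp_def by (intro suminf_ennreal_2dimen) auto
  also have "\<dots> \<le> (\<Sum>n. ?H (A n) + e * (1/2) ^ Suc n)"
    by (intro suminf_le B) auto
  also have "\<dots> = (\<Sum>n. ?H (A n)) + (\<Sum>n. ennreal e * ennreal ((1/2) ^ Suc n))"
    using \<open>0 < e\<close> by (subst suminf_add[symmetric])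
                     (auto simp del: ennreal_suminf_cmult simp add: ennreal_mult[symmetric])
  also have "\<dots> = (\<Sum>n. ?H (A n)) + e"
    unfolding ennreal_suminf_cmult
    by (subst suminf_ennreal_eq[OF zero_le_power power_half_series]) auto
  finally show "?H (\<Union>i. A i) \<le> (\<Sum>n. ?H (A n)) + e" .
qed

lemma hausdorff_content_le_outer: "0 < \<delta> \<Longrightarrow> hausdorff_content s \<delta> A \<le> hausdorff_outer s A"
  unfolding hausdorff_outer_def by (rule SUP_upper) simp

lemma hausdorff_outer_mono: "A \<subseteq> B \<Longrightarrow> hausdorff_outer s A \<le> hausdorff_outer s B"
  unfolding hausdorff_outer_def by (intro SUP_mono) (auto intro: hausdorff_content_mono)

lemma hausdorff_outer_empty: "hausdorff_outer s {} = 0"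
  unfolding hausdorff_outer_def by (intro antisym SUP_least) (auto simp: hausdorff_content_empty)

lemma hausdorff_outer_UN_le: "hausdorff_outer s (\<Union>i. A i) \<le> (\<Sum>i. hausdorff_outer s (A i))"
  unfolding hausdorff_outer_def[of s "\<Union>i. A i"]
proof (rule SUP_least)
  fix \<delta> :: real assume "\<delta> \<in> {0<..}"
  then show "hausdorff_content s \<delta> (\<Union>i. A i) \<le> (\<Sum>i. hausdorff_outer s (A i))"
    by (intro order_trans[OF hausdorff_content_UN_le] suminf_le hausdorff_content_le_outer) auto
qed

lemma hausdorff_outer_Un_le: "hausdorff_outer s (A \<union> B) \<le> hausdorff_outer s A + hausdorff_outer s B"
  using hausdorff_outer_UN_le[of s "binaryset A B"]
  by (simp add: UN_binaryset_eq suminf_binaryset_eq hausdorff_outer_empty)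

text \<open>
  A set of diameter less than \<open>\<epsilon>\<close> cannot meet both \<open>A\<close> and \<open>B\<close>, so a cover of \<open>A \<union> B\<close> by such sets
  splits into a cover of \<open>A\<close> and a cover of \<open>B\<close>.  Fine covers are the only ones that matter, because
  the contents increase as \<open>\<delta>\<close> decreases.
\<close>

lemma hausdorff_outer_Un_separated:
  assumes "0 < \<epsilon>" and sep: "\<And>x y. x \<in> A \<Longrightarrow> y \<in> B \<Longrightarrow> \<epsilon> \<le> dist x y"
  shows "hausdorff_outer s A + hausdorff_outer s B \<le> hausdorff_outer s (A \<union> B)"
proof -
  let ?H = "hausdorff_content s"
  have small: "?H \<delta> A + ?H \<delta> B \<le> hausdorff_outer s (A \<union> B)" if "0 < \<delta>" "\<delta> < \<epsilon>" for \<delta>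
  proof -
    have "?H \<delta> A + ?H \<delta> B \<le> (\<Sum>n. hausdorff_gauge s (C n))"
      if C: "A \<union> B \<subseteq> (\<Union>n. C n)" "\<And>n. bounded (C n)" "\<And>n. diameter (C n) \<le> \<delta>" for C :: "nat \<Rightarrow> _"
    proof -
      define CA where "CA n = (if C n \<inter> A \<noteq> {} then C n else {})" for n
      define CB where "CB n = (if C n \<inter> A \<noteq> {} then {} else C n)" for n
      have "B \<subseteq> (\<Union>n. CB n)"
      proof
        fix y assume "y \<in> B"
        then obtain n where n: "y \<in> C n" using C(1) by auto
        have "C n \<inter> A = {}"
        proof (rule ccontr)
          assume "C n \<inter> A \<noteq> {}"
          then obtain x where x: "x \<in> C n" "x \<in> A" by auto
          have "\<epsilon> \<le> dist x y" using sep x \<open>y \<in> B\<close> by auto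
          also have "\<dots> \<le> diameter (C n)" using C x n by (intro diameter_bounded_bound) auto
          also have "\<dots> \<le> \<delta>" using C by auto
          finally show False using \<open>\<delta> < \<epsilon>\<close> by simp
        qed
        then show "y \<in> (\<Union>n. CB n)" using n by (auto simp: CB_def)
      qed
      then have "?H \<delta> B \<le> (\<Sum>n. hausdorff_gauge s (CB n))"
        using C \<open>0 < \<delta>\<close> by (intro hausdorff_content_le) (auto simp: CB_def)
      moreover have "A \<subseteq> (\<Union>n. CA n)"
        using C(1) by (fastforce simp: CA_def)
      then have "?H \<delta> A \<le> (\<Sum>n. hausdorff_gauge s (CA n))"
        using C \<open>0 < \<delta>\<close> by (intro hausdorff_content_le) (auto simp: CA_def)
      ultimately have "?H \<delta> A + ?H \<delta> B \<le>
          (\<Sum>n. hausdorff_gauge s (CA n)) + (\<Sum>n. hausdorff_gauge s (CB n))"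
        by (intro add_mono)
      also have "\<dots> = (\<Sum>n. hausdorff_gauge s (CA n) + hausdorff_gauge s (CB n))"
        by (intro suminf_add) auto
      also have "\<dots> = (\<Sum>n. hausdorff_gauge s (C n))"
        by (intro suminf_cong) (auto simp: CA_def CB_def hausdorff_gauge_def)
      finally show ?thesis .
    qed
    then have "?H \<delta> A + ?H \<delta> B \<le> ?H \<delta> (A \<union> B)"
      unfolding hausdorff_content_def[of s \<delta> "A \<union> B"] by (intro INF_greatest) auto
    also have "\<dots> \<le> hausdorff_outer s (A \<union> B)"
      using that by (intro hausdorff_content_le_outer)
    finally show ?thesis .
  qed
  have all: "?H \<delta> A + ?H \<delta> B \<le> hausdorff_outer s (A \<union> B)" if "0 < \<delta>" for \<delta>
  proof -
    have "?H \<delta> A + ?H \<delta> B \<le> ?H (min \<delta> (\<epsilon>/2)) A + ?H (min \<delta> (\<epsilon>/2)) B"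
      by (intro add_mono hausdorff_content_antimono) auto
    also have "\<dots> \<le> hausdorff_outer s (A \<union> B)"
      using that \<open>0 < \<epsilon>\<close> by (intro small) auto
    finally show ?thesis .
  qed
  have "hausdorff_outer s A + hausdorff_outer s B = (SUP \<delta>\<in>{0<..}. ?H \<delta> A + ?H \<delta> B)"
    unfolding hausdorff_outer_def
  proof (rule SUP_add_directed_ennreal[symmetric])
    fix \<delta> \<delta>' :: real assume "\<delta> \<in> {0<..}" "\<delta>' \<in> {0<..}"
    then show "\<exists>k\<in>{0<..}. ?H \<delta> A + ?H \<delta>' B \<le> ?H k A + ?H k B"
      by (intro bexI[of _ "min \<delta> \<delta>'"] add_mono hausdorff_content_antimono) auto
  qed
  also have "\<dots> \<le> hausdorff_outer s (A \<union> B)"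
    by (intro SUP_least all) auto
  finally show ?thesis .
qed

text \<open>
  Caratheodory's criterion for a set \<open>A\<close> of finite measure.  The sets \<open>S n\<close> of points of \<open>A\<close> at
  distance more than \<open>1 / (n + 1)\<close> from \<open>F\<close> exhaust \<open>A - F\<close> and are separated from \<open>F\<close>, so it suffices
  that the shells \<open>R n\<close> between them have finite total measure.  This holds because shells that are not
  adjacent are separated from each other.
\<close>

lemma hausdorff_outer_closed_split:
  assumes "closed F" "F \<noteq> {}"
  shows "hausdorff_outer s (A \<inter> F) + hausdorff_outer s (A - F) \<le> hausdorff_outer s A"
proof -
  let ?H = "hausdorff_outer s"
  define S where "S n = {x \<in> A. 1 / real (Suc n) < infdist x F}" for n
  define R where "R n = S (Suc n) - S n" for n
  have S_mono: "S n \<subseteq> S (Suc n)" for n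
  proof -
    have "1 / real (Suc (Suc n)) \<le> 1 / real (Suc n)" by (simp add: field_simps)
    then show ?thesis unfolding S_def by force
  qed
  have far: "?H (A \<inter> F) + ?H (S n) \<le> ?H A" for n
  proof -
    have "?H (A \<inter> F) + ?H (S n) \<le> ?H ((A \<inter> F) \<union> S n)"
    proof (rule hausdorff_outer_Un_separated)
      fix x y assume "x \<in> A \<inter> F" "y \<in> S n"
      then show "1 / real (Suc n) \<le> dist x y"
        using infdist_le[of x F y] by (auto simp: S_def dist_commute)
    qed simp
    also have "\<dots> \<le> ?H A" by (intro hausdorff_outer_mono) (auto simp: S_def)
    finally show ?thesis .
  qed
  have shell: "?H (S n) + ?H (R (Suc n)) \<le> ?H (S (Suc (Suc n)))" for n
  proof -
    have "?H (S n) + ?H (R (Suc n)) \<le> ?H (S n \<union> R (Suc n))"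
    proof (rule hausdorff_outer_Un_separated)
      show "0 < 1 / real (Suc n) - 1 / real (Suc (Suc n))"
        by (simp add: field_simps add_pos_nonneg)
      fix x y assume "x \<in> S n" "y \<in> R (Suc n)"
      then have "1 / real (Suc n) < infdist x F" "infdist y F \<le> 1 / real (Suc (Suc n))"
        by (auto simp: S_def R_def)
      moreover have "infdist x F \<le> infdist y F + dist x y" by (rule infdist_triangle)
      ultimately show "1 / real (Suc n) - 1 / real (Suc (Suc n)) \<le> dist x y" by linarith
    qed
    also have "\<dots> \<le> ?H (S (Suc (Suc n)))"
      using S_mono[of n] S_mono[of "Suc n"] by (intro hausdorff_outer_mono) (auto simp: R_def)
    finally show ?thesis .
  qed
  \<comment> \<open>The two terms on the right carry the shells of even and of odd index.\<close>
  have partial: "(\<Sum>k<n. ?H (R (Suc k))) \<le> ?H (S n) + ?H (S (Suc n))" for n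
  proof (induction n)
    case (Suc n)
    have "(\<Sum>k<Suc n. ?H (R (Suc k))) \<le> (?H (S n) + ?H (S (Suc n))) + ?H (R (Suc n))"
      using Suc by (simp add: add_right_mono)
    also have "\<dots> = ?H (S (Suc n)) + (?H (S n) + ?H (R (Suc n)))" by (simp add: ac_simps)
    also have "\<dots> \<le> ?H (S (Suc n)) + ?H (S (Suc (Suc n)))"
      by (intro add_left_mono shell)
    finally show ?case .
  qed simp
  have S_A: "?H (S n) \<le> ?H A" for n
    by (intro hausdorff_outer_mono) (auto simp: S_def)
  show ?thesis
  proof (cases "?H A = \<infinity>")
    case False
    define T where "T = (\<Sum>k. ?H (R (Suc k)))"
    have "T \<le> ?H A + ?H A"
      unfolding T_def
    proof (rule suminf_le_const)
      show "(\<Sum>k<n. ?H (R (Suc k))) \<le> ?H A + ?H A" for n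
        using partial[of n] S_A[of n] S_A[of "Suc n"] by (meson add_mono order_trans)
    qed simp
    with False have T: "T \<noteq> \<infinity>" by (auto simp: top_unique)
    \<comment> \<open>A point of \<open>A - F\<close> outside \<open>S (Suc n)\<close> lies in the shell just below the first \<open>S m0\<close> that contains it.\<close>
    have cover: "A - F \<subseteq> S (Suc n) \<union> (\<Union>k. R (Suc (n + k)))" for n
    proof
      fix x assume x: "x \<in> A - F"
      then have "0 < infdist x F"
        using assms by (metis DiffD2 in_closed_iff_infdist_zero infdist_nonneg less_eq_real_def)
      then obtain m where "1 / real (Suc m) < infdist x F"
        using nat_approx_posE by blast
      with x have ex: "x \<in> S m" by (auto simp: S_def)
      define m0 where "m0 = (LEAST m. x \<in> S m)"
      have m0: "x \<in> S m0" "\<And>k. k < m0 \<Longrightarrow> x \<notin> S k"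
        unfolding m0_def using ex by (auto intro: LeastI dest: not_less_Least)
      have incS: "incseq S" using S_mono by (rule incseq_SucI)
      show "x \<in> S (Suc n) \<union> (\<Union>k. R (Suc (n + k)))"
      proof (cases "m0 \<le> Suc n")
        case True
        then show ?thesis using m0 incS by (auto dest: incseqD)
      next
        case False
        then obtain k where k: "m0 = Suc (Suc (n + k))"
          by (metis add_Suc less_imp_Suc_add not_le)
        then have "x \<in> R (Suc (n + k))" using m0 by (auto simp: R_def)
        then show ?thesis by auto
      qed
    qed
    \<comment> \<open>Adding the first \<open>n\<close> shells on both sides completes the tail of the series to its sum \<open>T\<close>, which
      is finite and cancels in the limit.\<close>
    have split: "?H (A \<inter> F) + ?H (A - F) + (\<Sum>k<n. ?H (R (Suc k))) \<le> ?H A + T" for n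
    proof -
      have "?H (A - F) \<le> ?H (S (Suc n) \<union> (\<Union>k. R (Suc (n + k))))"
        by (intro hausdorff_outer_mono cover)
      also have "\<dots> \<le> ?H (S (Suc n)) + ?H (\<Union>k. R (Suc (n + k)))"
        by (rule hausdorff_outer_Un_le)
      also have "\<dots> \<le> ?H (S (Suc n)) + (\<Sum>k. ?H (R (Suc (n + k))))"
        by (intro add_left_mono hausdorff_outer_UN_le)
      finally have *: "?H (A - F) \<le> ?H (S (Suc n)) + (\<Sum>k. ?H (R (Suc (n + k))))" .
      have "T = (\<Sum>k. ?H (R (Suc (k + n)))) + (\<Sum>k<n. ?H (R (Suc k)))"
        unfolding T_def by (rule suminf_offset) simp
      then have T_split: "T = (\<Sum>k. ?H (R (Suc (n + k)))) + (\<Sum>k<n. ?H (R (Suc k)))"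
        by (simp add: add.commute)
      have "?H (A \<inter> F) + ?H (A - F) + (\<Sum>k<n. ?H (R (Suc k)))
          \<le> ?H (A \<inter> F) + (?H (S (Suc n)) + (\<Sum>k. ?H (R (Suc (n + k))))) + (\<Sum>k<n. ?H (R (Suc k)))"
        using * by (intro add_mono) auto
      also have "\<dots> = (?H (A \<inter> F) + ?H (S (Suc n))) + T"
        unfolding T_split by (simp add: ac_simps)
      also have "\<dots> \<le> ?H A + T" by (intro add_right_mono far)
      finally show ?thesis .
    qed
    have "?H (A \<inter> F) + ?H (A - F) + T \<le> ?H A + T"
    proof (rule LIMSEQ_le_const2)
      show "(\<lambda>n. ?H (A \<inter> F) + ?H (A - F) + (\<Sum>k<n. ?H (R (Suc k)))) \<longlonglongrightarrow>
          ?H (A \<inter> F) + ?H (A - F) + T"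
        unfolding T_def by (intro tendsto_add tendsto_const summable_LIMSEQ) simp
    qed (use split in auto)
    then show ?thesis
      using T by (simp add: ennreal_add_left_cancel_le add.commute[of _ T])
  qed simp
qed

lemma closed_in_lambda_system:
  assumes "closed F" shows "F \<in> lambda_system UNIV UNIV (hausdorff_outer s)"
proof (cases "F = {}")
  case True
  then show ?thesis by (simp add: lambda_system_def hausdorff_outer_empty)
next
  case False
  have "hausdorff_outer s (F \<inter> A) + hausdorff_outer s ((UNIV - F) \<inter> A) = hausdorff_outer s A" for A
  proof -
    have eq: "F \<inter> A = A \<inter> F" "(UNIV - F) \<inter> A = A - F" by auto
    have "A = (A \<inter> F) \<union> (A - F)" by auto
    then have "hausdorff_outer s A \<le> hausdorff_outer s (A \<inter> F) + hausdorff_outer s (A - F)"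
      using hausdorff_outer_Un_le[of s "A \<inter> F" "A - F"] by simp
    with hausdorff_outer_closed_split[OF assms False, of s A] show ?thesis
      unfolding eq by (rule antisym)
  qed
  then show ?thesis by (simp add: lambda_system_def)
qed

lemma measure_space_hausdorff_outer:
  "measure_space UNIV (lambda_system UNIV UNIV (hausdorff_outer s)) (hausdorff_outer s)"
proof -
  interpret sigma_algebra "UNIV :: 'a set" UNIV
    using sigma_algebra_Pow[of "UNIV :: 'a set"] by simp
  have "outer_measure_space UNIV (hausdorff_outer s :: 'a set \<Rightarrow> ennreal)"
    by (auto simp: outer_measure_space_def positive_def increasing_def countably_subadditive_def
        hausdorff_outer_empty hausdorff_outer_UN_le hausdorff_outer_mono)
  from caratheodory_lemma[OF this] show ?thesis .
qed

lemma sets_hausdorff_measure: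
  "sets (hausdorff_measure s :: 'a::euclidean_space measure) =
    lambda_system UNIV UNIV (hausdorff_outer s)"
proof -
  have "sigma_algebra UNIV (lambda_system UNIV UNIV (hausdorff_outer s :: 'a set \<Rightarrow> ennreal))"
    using measure_space_hausdorff_outer by (auto simp: measure_space_def)
  then show ?thesis
    unfolding hausdorff_measure_def by (simp add: sigma_algebra.sigma_sets_eq)
qed

lemma space_hausdorff_measure [simp]: "space (hausdorff_measure s) = UNIV"
  unfolding hausdorff_measure_def by (simp add: space_measure_of_conv)

lemma emeasure_hausdorff_measure:
  assumes "A \<in> sets (hausdorff_measure s)"
  shows "emeasure (hausdorff_measure s) A = hausdorff_outer s A"
  using assms measure_space_hausdorff_outer[of s]
  unfolding sets_hausdorff_measure unfolding hausdorff_measure_def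
  by (intro emeasure_measure_of_sigma) (auto simp: measure_space_def)

lemma borel_subset_hausdorff: "sets borel \<subseteq> sets (hausdorff_measure s)"
proof -
  have "sets borel = sigma_sets UNIV (Collect closed :: 'a set set)"
    by (subst borel_eq_closed) simp
  also have "\<dots> \<subseteq> sets (hausdorff_measure s)"
    using sets.sigma_sets_subset[of "Collect closed" "hausdorff_measure s"]
      closed_in_lambda_system[where s = s]
    by (auto simp: sets_hausdorff_measure)
  finally show ?thesis .
qed

lemma borel_measurable_hausdorff:
  assumes "f \<in> borel_measurable borel" shows "f \<in> borel_measurable (hausdorff_measure s)"
  using assms borel_subset_hausdorff[of s] by (auto simp: measurable_def)

section \<open>Arc length on straight lines\<close>

lemma hausdorff_gauge_1 [simp]: "hausdorff_gauge (Suc 0) C = ennreal (diameter C)"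
  by (simp add: hausdorff_gauge_def)

text \<open>
  A division into \<open>m\<close> equal pieces is a cover whose diameters add up to the length.
\<close>

lemma hausdorff_outer_1_segment_le:
  fixes p i :: "'a::euclidean_space"
  assumes "norm i = 1" "a \<le> b"
  shows "hausdorff_outer (Suc 0) ((\<lambda>t. p + t *\<^sub>R i) ` {a..b}) \<le> ennreal (b - a)"
  unfolding hausdorff_outer_def
proof (rule SUP_least)
  let ?e = "\<lambda>t. p + t *\<^sub>R i"
  fix \<delta> :: real assume "\<delta> \<in> {0<..}"
  then have "0 < \<delta>" by simp
  obtain N where N: "(b - a) / \<delta> < real N" using reals_Archimedean2 by blast
  define m where "m = Suc N"
  have m: "m > 0" "(b - a) / real m \<le> \<delta>"
    using N \<open>0 < \<delta>\<close> by (auto simp: m_def field_simps)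
  define d where "d = (b - a) / real m"
  have d: "0 \<le> d" "d \<le> \<delta>" "real m * d = b - a" using assms m by (auto simp: d_def)
  define C where "C n = (if n < m then ?e ` {a + real n * d..a + real (Suc n) * d} else {})" for n
  have dist_e: "dist (?e s) (?e t) = \<bar>s - t\<bar>" for s t
    using assms by (simp add: dist_norm scaleR_diff_left[symmetric])
  have diam: "diameter (C n) \<le> d" for n
    unfolding C_def using d
    by (auto intro!: diameter_le simp: dist_norm[symmetric] dist_e assms(1) abs_le_iff algebra_simps)
  have bnd: "bounded (C n)" for n
    unfolding C_def
    by (auto intro!: compact_imp_bounded compact_continuous_image continuous_intros)
  have cover: "?e ` {a..b} \<subseteq> (\<Union>n. C n)"
  proof
    fix x assume "x \<in> ?e ` {a..b}"
    then obtain t where t': "x = ?e t" "t \<in> {a..b}" by blast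
    then have t: "x = ?e t" "a \<le> t" "t \<le> b" by simp_all
    have "\<exists>n<m. t \<in> {a + real n * d..a + real (Suc n) * d}"
    proof (cases "t = b")
      case True
      have "real (m - 1) = real m - 1" using m by simp
      then show ?thesis using True m d
        by (intro exI[of _ "m - 1"]) (auto simp: algebra_simps)
    next
      case False
      with t have "a < b" by simp
      with m have "0 < d" by (simp add: d_def)
      define n where "n = nat \<lfloor>(t - a) / d\<rfloor>"
      have "0 \<le> (t - a) / d" using t \<open>0 < d\<close> by simp
      then have n: "real n \<le> (t - a) / d" "(t - a) / d < real n + 1"
        unfolding n_def by linarith+
      have "(t - a) / d < real m" using t False d \<open>0 < d\<close> by (simp add: field_simps)
      with n have "n < m" by linarith
      with n \<open>0 < d\<close> show ?thesis by (intro exI[of _ n]) (auto simp: field_simps)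
    qed
    then obtain n where "n < m" "t \<in> {a + real n * d..a + real (Suc n) * d}" by blast
    moreover from this have "x \<in> ?e ` {a + real n * d..a + real (Suc n) * d}"
      using t(1) by blast
    ultimately have "x \<in> C n" unfolding C_def by simp
    then show "x \<in> (\<Union>n. C n)" by blast
  qed
  have "hausdorff_content (Suc 0) \<delta> (?e ` {a..b}) \<le> (\<Sum>n. hausdorff_gauge (Suc 0) (C n))"
    using diam d bnd cover by (intro hausdorff_content_le) (auto intro: order_trans)
  also have "\<dots> = (\<Sum>n<m. ennreal (diameter (C n)))"
    by (subst suminf_finite[of "{..<m}"]) (auto simp: C_def)
  also have "\<dots> \<le> (\<Sum>n<m. ennreal d)"
    using diam by (intro sum_mono ennreal_leI)
  also have "\<dots> = ennreal (b - a)"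
    using d by (simp add: ennreal_of_nat_eq_real_of_nat ennreal_mult[symmetric])
  finally show "hausdorff_content (Suc 0) \<delta> (?e ` {a..b}) \<le> ennreal (b - a)" .
qed

text \<open>
  The orthogonal projection to the line maps a set of diameter \<open>d\<close> into an interval of length \<open>d\<close>.
  Hence the projections of a cover of the segment are contained in intervals that cover \<open>(a, b)\<close>, and
  Lebesgue measure bounds the sum of their lengths from below.
\<close>

lemma hausdorff_outer_1_segment_ge:
  fixes p i :: "'a::euclidean_space"
  assumes "norm i = 1" "a \<le> b"
  shows "ennreal (b - a) \<le> hausdorff_outer (Suc 0) ((\<lambda>t. p + t *\<^sub>R i) ` {a<..<b})"
proof -
  let ?e = "\<lambda>t. p + t *\<^sub>R i" and ?\<pi> = "\<lambda>x. (x - p) \<bullet> i"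
  have \<pi>_e: "?\<pi> (?e t) = t" for t using assms by (simp add: norm_eq_1)
  have "ennreal (b - a) \<le> hausdorff_content (Suc 0) 1 (?e ` {a<..<b})"
    unfolding hausdorff_content_def
  proof (rule INF_greatest, clarify)
    fix C :: "nat \<Rightarrow> 'a set"
    assume cover: "?e ` {a<..<b} \<subseteq> (\<Union>n. C n)"
      and C: "\<forall>n. bounded (C n) \<and> diameter (C n) \<le> 1"
    have "\<exists>l. ?\<pi> ` C n \<subseteq> {l..l + diameter (C n)}" for n
    proof (cases "C n = {}")
      case False
      define l where "l = Inf (?\<pi> ` C n)"
      have "bounded ((\<lambda>x. x \<bullet> i) ` (\<lambda>x. x - p) ` C n)"
        using C by (intro bounded_linear_image bounded_linear_inner_left bounded_translation_minus) auto
      then have "bounded (?\<pi> ` C n)" by (simp add: image_image)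
      then have bdd: "bdd_below (?\<pi> ` C n)" by (rule bounded_imp_bdd_below)
      have "?\<pi> x - diameter (C n) \<le> l" if x: "x \<in> C n" for x
        unfolding l_def
      proof (rule cINF_greatest[OF False])
        fix y assume y: "y \<in> C n"
        have "?\<pi> x - ?\<pi> y = (x - y) \<bullet> i" by (simp add: inner_diff_left)
        also have "\<dots> \<le> norm (x - y)" using norm_cauchy_schwarz[of "x - y" i] assms by simp
        also have "\<dots> \<le> diameter (C n)"
          using C x y diameter_bounded_bound[of "C n" x y] by (simp add: dist_norm)
        finally show "?\<pi> x - diameter (C n) \<le> ?\<pi> y" by simp
      qed
      moreover have "l \<le> ?\<pi> x" if "x \<in> C n" for x
        unfolding l_def using that by (intro cINF_lower bdd)
      ultimately show ?thesis by (intro exI[of _ l]) (auto simp: algebra_simps)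
    qed simp
    then obtain l where l: "\<And>n. ?\<pi> ` C n \<subseteq> {l n..l n + diameter (C n)}" by metis
    have "{a<..<b} \<subseteq> (\<Union>n. {l n..l n + diameter (C n)})"
    proof
      fix t assume "t \<in> {a<..<b}"
      then obtain n where "?e t \<in> C n" using cover by blast
      then have "?\<pi> (?e t) \<in> {l n..l n + diameter (C n)}" using l by blast
      then show "t \<in> (\<Union>n. {l n..l n + diameter (C n)})" unfolding \<pi>_e by blast
    qed
    then have "emeasure lborel {a<..<b} \<le> emeasure lborel (\<Union>n. {l n..l n + diameter (C n)})"
      by (intro emeasure_mono) auto
    also have "\<dots> \<le> (\<Sum>n. emeasure lborel {l n..l n + diameter (C n)})"
      by (intro emeasure_subadditive_countably) auto
    also have "\<dots> = (\<Sum>n. hausdorff_gauge (Suc 0) (C n))"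
      using C by (intro suminf_cong) (simp add: diameter_ge_0)
    finally show "ennreal (b - a) \<le> (\<Sum>n. hausdorff_gauge (Suc 0) (C n))"
      using assms by simp
  qed
  also have "\<dots> \<le> hausdorff_outer (Suc 0) (?e ` {a<..<b})"
    by (rule hausdorff_content_le_outer) simp
  finally show ?thesis .
qed

lemma hausdorff_outer_1_segment:
  fixes p i :: "'a::euclidean_space"
  assumes "norm i = 1" "a \<le> b"
  shows "hausdorff_outer (Suc 0) ((\<lambda>t. p + t *\<^sub>R i) ` {a<..<b}) = ennreal (b - a)"
proof (rule antisym)
  have "hausdorff_outer (Suc 0) ((\<lambda>t. p + t *\<^sub>R i) ` {a<..<b})
      \<le> hausdorff_outer (Suc 0) ((\<lambda>t. p + t *\<^sub>R i) ` {a..b})"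
    by (intro hausdorff_outer_mono) auto
  also have "\<dots> \<le> ennreal (b - a)" by (rule hausdorff_outer_1_segment_le[OF assms])
  finally show "hausdorff_outer (Suc 0) ((\<lambda>t. p + t *\<^sub>R i) ` {a<..<b}) \<le> ennreal (b - a)" .
qed (rule hausdorff_outer_1_segment_ge[OF assms])

lemma line_image_eq:
  fixes p i :: "'a::euclidean_space"
  assumes "norm i = 1"
  shows "(\<lambda>t. p + t *\<^sub>R i) ` B = range (\<lambda>t. p + t *\<^sub>R i) \<inter> (\<lambda>x. (x - p) \<bullet> i) -` B"
  using assms by (auto simp: norm_eq_1)

lemma closed_line: "closed (range (\<lambda>t. p + t *\<^sub>R (i::'a::euclidean_space)))"
proof -
  have "range (\<lambda>t. p + t *\<^sub>R i) = (+) p ` span {i}"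
    by (auto simp: span_singleton image_iff)
  then show ?thesis by (simp add: closed_translation)
qed

lemma borel_line_image:
  fixes p i :: "'a::euclidean_space"
  assumes "norm i = 1" "B \<in> sets borel"
  shows "(\<lambda>t. p + t *\<^sub>R i) ` B \<in> sets borel"
proof -
  have "(\<lambda>x. (x - p) \<bullet> i) -` B \<in> sets borel"
    using measurable_sets_borel[of "\<lambda>x. (x - p) \<bullet> i" borel B] assms(2) by simp
  then show ?thesis
    unfolding line_image_eq[OF assms(1), of p B] by (intro sets.Int) (auto intro: borel_closed closed_line)
qed

text \<open>
  A measure on the real line is Lebesgue measure as soon as it agrees with it on open intervals.
\<close>

lemma distr_hausdorff_line:
  fixes p i :: "'a::euclidean_space"
  assumes i: "norm i = 1"
  shows "distr (restrict_space (hausdorff_measure (Suc 0)) (range (\<lambda>t. p + t *\<^sub>R i)))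
           borel (\<lambda>x. (x - p) \<bullet> i) = lborel"
proof -
  let ?\<mu> = "hausdorff_measure (Suc 0) :: 'a measure"
  let ?L = "range (\<lambda>t. p + t *\<^sub>R i)"
  let ?\<pi> = "\<lambda>x. (x - p) \<bullet> i"
  have L: "?L \<in> sets ?\<mu>"
    using closed_line borel_closed borel_subset_hausdorff by blast
  have meas: "?\<pi> \<in> measurable (restrict_space ?\<mu> ?L) borel"
    by (intro measurable_restrict_space1 borel_measurable_hausdorff) simp
  show ?thesis
  proof (rule lborel_eqI[symmetric])
    fix l u :: real assume "\<And>b. b \<in> Basis \<Longrightarrow> l \<bullet> b \<le> u \<bullet> b"
    then have lu: "l \<le> u" by simp
    have "emeasure (distr (restrict_space ?\<mu> ?L) borel ?\<pi>) (box l u)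
        = emeasure (restrict_space ?\<mu> ?L) (?\<pi> -` {l<..<u} \<inter> ?L)"
      by (subst emeasure_distr[OF meas]) (auto simp: space_restrict_space box_real)
    also have "?\<pi> -` {l<..<u} \<inter> ?L = (\<lambda>t. p + t *\<^sub>R i) ` {l<..<u}"
      unfolding line_image_eq[OF i, of p "{l<..<u}"] by auto
    also have "emeasure (restrict_space ?\<mu> ?L) \<dots> = emeasure ?\<mu> \<dots>"
      using L by (intro emeasure_restrict_space) auto
    also have "\<dots> = ennreal (u - l)"
      using borel_line_image[OF i, of "{l<..<u}" p] borel_subset_hausdorff
      by (subst emeasure_hausdorff_measure) (auto simp: hausdorff_outer_1_segment[OF i lu])
    finally show "emeasure (distr (restrict_space ?\<mu> ?L) borel ?\<pi>) (box l u)
        = ennreal (\<Prod>b\<in>Basis. (u - l) \<bullet> b)" by simp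
  qed simp
qed

lemma emeasure_hausdorff_line:
  fixes p i :: "'a::euclidean_space"
  assumes i: "norm i = 1" and B: "B \<in> sets borel"
  shows "emeasure (hausdorff_measure (Suc 0)) ((\<lambda>t. p + t *\<^sub>R i) ` B) = emeasure lborel B"
proof -
  let ?\<mu> = "hausdorff_measure (Suc 0) :: 'a measure"
  let ?L = "range (\<lambda>t. p + t *\<^sub>R i)"
  let ?\<pi> = "\<lambda>x. (x - p) \<bullet> i"
  have L: "?L \<in> sets ?\<mu>"
    using closed_line borel_closed borel_subset_hausdorff by blast
  have meas: "?\<pi> \<in> measurable (restrict_space ?\<mu> ?L) borel"
    by (intro measurable_restrict_space1 borel_measurable_hausdorff) simp
  have "emeasure lborel B = emeasure (distr (restrict_space ?\<mu> ?L) borel ?\<pi>) B"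
    by (simp add: distr_hausdorff_line[OF i])
  also have "\<dots> = emeasure (restrict_space ?\<mu> ?L) (?\<pi> -` B \<inter> ?L)"
    using B by (subst emeasure_distr[OF meas]) (auto simp: space_restrict_space)
  also have "?\<pi> -` B \<inter> ?L = (\<lambda>t. p + t *\<^sub>R i) ` B"
    unfolding line_image_eq[OF i, of p B] by auto
  also have "emeasure (restrict_space ?\<mu> ?L) \<dots> = emeasure ?\<mu> \<dots>"
    using L by (intro emeasure_restrict_space) auto
  finally show ?thesis ..
qed

lemma set_integral_hausdorff_line:
  fixes p i :: "'a::euclidean_space" and f :: "'a \<Rightarrow> real"
  assumes i: "norm i = 1" and B: "B \<in> sets borel" and f: "f \<in> borel_measurable borel"
  shows "(LINT x:(\<lambda>t. p + t *\<^sub>R i) ` B|hausdorff_measure (Suc 0). f x) = (LINT t:B|lborel. f (p + t *\<^sub>R i))"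
    and "set_integrable (hausdorff_measure (Suc 0)) ((\<lambda>t. p + t *\<^sub>R i) ` B) f \<longleftrightarrow>
      set_integrable lborel B (\<lambda>t. f (p + t *\<^sub>R i))"
proof -
  let ?\<mu> = "hausdorff_measure (Suc 0) :: 'a measure"
  let ?L = "range (\<lambda>t. p + t *\<^sub>R i)"
  let ?\<pi> = "\<lambda>x. (x - p) \<bullet> i"
  let ?F = "\<lambda>t. indicator B t *\<^sub>R f (p + t *\<^sub>R i)"
  have L: "?L \<inter> space ?\<mu> \<in> sets ?\<mu>"
    using closed_line[of p i] borel_closed borel_subset_hausdorff by auto
  have meas: "?\<pi> \<in> measurable (restrict_space ?\<mu> ?L) borel"
    by (intro measurable_restrict_space1 borel_measurable_hausdorff) simp
  have F: "?F \<in> borel_measurable borel" using f B by measurable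
  have eq: "indicator ?L x *\<^sub>R ?F (?\<pi> x) = indicator ((\<lambda>t. p + t *\<^sub>R i) ` B) x *\<^sub>R f x" for x
    using i unfolding line_image_eq[OF i, of p B] by (auto simp: indicator_def norm_eq_1)
  have "(LINT t:B|lborel. f (p + t *\<^sub>R i)) = (LINT t|distr (restrict_space ?\<mu> ?L) borel ?\<pi>. ?F t)"
    by (simp add: distr_hausdorff_line[OF i] set_lebesgue_integral_def)
  also have "\<dots> = (LINT x|restrict_space ?\<mu> ?L. ?F (?\<pi> x))"
    by (rule integral_distr[OF meas F])
  also have "\<dots> = (LINT x|?\<mu>. indicator ?L x *\<^sub>R ?F (?\<pi> x))"
    by (rule integral_restrict_space[OF L])
  finally show "(LINT x:(\<lambda>t. p + t *\<^sub>R i) ` B|?\<mu>. f x) = (LINT t:B|lborel. f (p + t *\<^sub>R i))"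
    unfolding eq by (simp add: set_lebesgue_integral_def)
  have "set_integrable lborel B (\<lambda>t. f (p + t *\<^sub>R i)) \<longleftrightarrow>
      integrable (distr (restrict_space ?\<mu> ?L) borel ?\<pi>) ?F"
    by (simp add: distr_hausdorff_line[OF i] set_integrable_def)
  also have "\<dots> \<longleftrightarrow> integrable (restrict_space ?\<mu> ?L) (\<lambda>x. ?F (?\<pi> x))"
    by (rule integrable_distr_eq[OF meas F])
  also have "\<dots> \<longleftrightarrow> integrable ?\<mu> (\<lambda>x. indicator ?L x *\<^sub>R ?F (?\<pi> x))"
    by (rule integrable_restrict_space[OF L])
  finally show "set_integrable ?\<mu> ((\<lambda>t. p + t *\<^sub>R i) ` B) f \<longleftrightarrow>
      set_integrable lborel B (\<lambda>t. f (p + t *\<^sub>R i))"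
    unfolding eq by (simp add: set_integrable_def)
qed

section \<open>Wirtinger inequalities on an interval\<close>

text \<open>
  The singularity of the cotangent is a simple pole.
\<close>

lemma tendsto_sq_mult_cot:
  fixes k s :: real
  assumes "k > 0"
  shows "((\<lambda>x. (x - s)\<^sup>2 * cot (k * (x - s))) \<longlongrightarrow> 0) (at s)"
proof -
  have "((\<lambda>x. sin (k * (x - s))) has_real_derivative k) (at s)"
    by (auto intro!: derivative_eq_intros)
  then have "((\<lambda>x. sin (k * (x - s)) / (x - s)) \<longlongrightarrow> k) (at s)"
    by (simp add: has_field_derivative_iff)
  then have "((\<lambda>x. inverse (sin (k * (x - s)) / (x - s))) \<longlongrightarrow> inverse k) (at s)"
    using assms by (intro tendsto_inverse) auto
  moreover have "((\<lambda>x. (x - s) * cos (k * (x - s))) \<longlongrightarrow> (s - s) * cos (k * (s - s))) (at s)"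
    by (intro tendsto_intros)
  ultimately have "((\<lambda>x. ((x - s) * cos (k * (x - s))) * inverse (sin (k * (x - s)) / (x - s))) \<longlongrightarrow>
      (s - s) * cos (k * (s - s)) * inverse k) (at s)"
    by (rule tendsto_mult[rotated])
  then show ?thesis by (simp add: cot_def power2_eq_square field_simps)
qed

lemma cot_add_of_sin_eq_0:
  fixes a b :: real
  assumes "sin b = 0" shows "cot (a + b) = cot a"
proof -
  have "cos b \<noteq> 0" using assms sin_cos_squared_add[of b] by auto
  then show ?thesis using assms by (simp add: cot_def cos_add sin_add)
qed

text \<open>
  The condition \<open>f 0 + f h = 0\<close> forces a zero \<open>c\<close> of \<open>f\<close>.  With \<open>k = \<pi> / h\<close> and
  \<open>G x = k cot (k (x - c)) (f x)\<^sup>2\<close>,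
    \<open>f'\<^sup>2 - k\<^sup>2 f\<^sup>2 - G' = (f' - k cot (k (x - c)) f)\<^sup>2 \<ge> 0\<close>,
  and \<open>G h = G 0\<close> because both \<open>f\<^sup>2\<close> and the cotangent take the same value at \<open>0\<close> and \<open>h\<close>.  So the
  integral of \<open>G'\<close> vanishes.  The bound on \<open>f'\<close> makes \<open>f\<^sup>2\<close> vanish to second order at its zeros, which
  beats the pole of the cotangent and makes \<open>G\<close> continuous.
\<close>

lemma antiperiodic_wirtinger:
  fixes f f' :: "real \<Rightarrow> real"
  assumes h: "0 < h" and cont: "continuous_on {0..h} f"
    and deriv: "\<And>x. 0 < x \<Longrightarrow> x < h \<Longrightarrow> (f has_real_derivative f' x) (at x)"
    and bound: "\<And>x. 0 < x \<Longrightarrow> x < h \<Longrightarrow> \<bar>f' x\<bar> \<le> K"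
    and int: "(\<lambda>x. (f' x)\<^sup>2) integrable_on {0..h}"
    and anti: "f 0 + f h = 0"
  shows "integral {0..h} (\<lambda>x. (f x)\<^sup>2) \<le> (h / pi)\<^sup>2 * integral {0..h} (\<lambda>x. (f' x)\<^sup>2)"
proof -
  define k where "k = pi / h"
  have k: "k > 0" "k * h = pi" using h by (auto simp: k_def)
  have lip: "\<bar>f x - f y\<bar> \<le> K * \<bar>x - y\<bar>" if xy: "x \<in> {0..h}" "y \<in> {0..h}" for x y
  proof -
    have *: "\<bar>f b - f a\<bar> \<le> K * (b - a)" if "a < b" "a \<in> {0..h}" "b \<in> {0..h}" for a b
    proof -
      have "continuous_on {a..b} f" using that by (intro continuous_on_subset[OF cont]) auto
      moreover have "(f has_derivative (*) (f' x)) (at x)" if "a < x" "x < b" for x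
        using deriv[of x] that \<open>a \<in> {0..h}\<close> \<open>b \<in> {0..h}\<close> by (simp add: has_field_derivative_def)
      ultimately obtain \<xi> where "a < \<xi>" "\<xi> < b" "f b - f a = f' \<xi> * (b - a)"
        using mvt[OF \<open>a < b\<close>, of f "\<lambda>x. (*) (f' x)"] by blast
      with that bound[of \<xi>] show ?thesis
        by (simp add: abs_mult mult.commute mult_right_mono)
    qed
    show ?thesis using *[of x y] *[of y x] xy by (cases x y rule: linorder_cases) (auto simp: abs_minus_commute)
  qed
  have "\<exists>c. 0 \<le> c \<and> c \<le> h \<and> f c = 0"
  proof (cases "f 0 \<le> 0")
    case True
    then show ?thesis using anti h cont by (intro IVT') auto
  next
    case False
    then show ?thesis using anti h cont by (intro IVT2') auto
  qed
  then obtain c where c: "0 \<le> c" "c \<le> h" "f c = 0" by auto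
  \<comment> \<open>At a pole the cotangent has the value \<open>0\<close>, by division by zero; this is the limit of \<open>G\<close> there.\<close>
  define G where "G x = k * cot (k * (x - c)) * (f x)\<^sup>2" for x
  have sin_nz: "sin (k * (x - c)) \<noteq> 0" if "0 < x" "x < h" "x \<noteq> c" for x
  proof -
    have "0 < k * \<bar>x - c\<bar>" using that k by simp
    moreover have "k * \<bar>x - c\<bar> < k * h" using that c k by (intro mult_strict_left_mono) auto
    ultimately have "sin (k * \<bar>x - c\<bar>) \<noteq> 0" using sin_gt_zero[of "k * \<bar>x - c\<bar>"] k(2) by simp
    then show ?thesis by (cases "x < c") (auto simp: abs_if right_diff_distrib sin_diff mult.commute)
  qed
  \<comment> \<open>The poles are \<open>c\<close> itself and, if \<open>c\<close> is an endpoint, the other endpoint, where \<open>f\<close> vanishes as well.\<close>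
  have f_zero: "f s = 0" if "s \<in> {0..h}" "sin (k * (s - c)) = 0" for s
  proof (cases "s = c")
    case False
    with that sin_nz[of s] have "s = 0 \<or> s = h" by force
    then show ?thesis
    proof
      assume "s = 0"
      then have "c \<noteq> 0" "sin (k * c) = 0" using that False by auto
      moreover have "k * c < k * h" if "c \<noteq> h" using k c that by (intro mult_strict_left_mono) auto
      ultimately have "c = h" using sin_gt_zero[of "k * c"] k c by force
      with c anti \<open>s = 0\<close> show ?thesis by simp
    next
      assume "s = h"
      then have "c \<noteq> h" "sin (k * h - k * c) = 0" using that False by (auto simp: right_diff_distrib)
      then have "sin (k * c) = 0" using k by (simp add: sin_diff)
      moreover have "k * c < k * h" using k c \<open>c \<noteq> h\<close> by (intro mult_strict_left_mono) auto
      ultimately have "c = 0" using sin_gt_zero[of "k * c"] k(1) c(1) unfolding k(2)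
        by (metis less_eq_real_def less_irrefl mult_pos_pos)
      with c anti \<open>s = h\<close> show ?thesis by simp
    qed
  qed (simp add: c)
  have contG: "continuous_on {0..h} G"
    unfolding continuous_on_eq_continuous_within
  proof
    fix s assume s: "s \<in> {0..h}"
    have f_s: "continuous (at s within {0..h}) f"
      using cont s by (simp add: continuous_on_eq_continuous_within)
    show "continuous (at s within {0..h}) G"
    proof (cases "sin (k * (s - c)) = 0")
      case False
      then show ?thesis
        unfolding G_def cot_def using f_s by (intro continuous_intros) auto
    next
      case True
      then have G_s: "G s = 0" by (simp add: G_def cot_def)
      have "((\<lambda>x. k * K\<^sup>2 * \<bar>(x - s)\<^sup>2 * cot (k * (x - s))\<bar>) \<longlongrightarrow> k * K\<^sup>2 * \<bar>0\<bar>) (at s)"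
        by (intro tendsto_intros tendsto_sq_mult_cot k)
      then have lim: "((\<lambda>x. k * K\<^sup>2 * \<bar>(x - s)\<^sup>2 * cot (k * (x - s))\<bar>) \<longlongrightarrow> 0) (at s within {0..h})"
        by (auto intro: tendsto_within_subset)
      have "norm (G x) \<le> k * K\<^sup>2 * \<bar>(x - s)\<^sup>2 * cot (k * (x - s))\<bar>" if x: "x \<in> {0..h}" for x
      proof -
        have "k * (x - c) = k * (x - s) + k * (s - c)" by (simp add: algebra_simps)
        then have "cot (k * (x - c)) = cot (k * (x - s))"
          using cot_add_of_sin_eq_0[OF True] by simp
        moreover have "(f x)\<^sup>2 \<le> K\<^sup>2 * (x - s)\<^sup>2"
        proof -
          have "\<bar>f x\<bar> \<le> K * \<bar>x - s\<bar>" using lip[OF x s] f_zero[OF s True] by simp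
          then have "\<bar>f x\<bar>\<^sup>2 \<le> (K * \<bar>x - s\<bar>)\<^sup>2" by (intro power_mono) auto
          then show ?thesis by (simp add: power_mult_distrib)
        qed
        then have "(f x)\<^sup>2 * (k * \<bar>cot (k * (x - s))\<bar>) \<le> K\<^sup>2 * (x - s)\<^sup>2 * (k * \<bar>cot (k * (x - s))\<bar>)"
          using k by (intro mult_right_mono) auto
        ultimately show ?thesis using k by (simp add: G_def abs_mult ac_simps)
      qed
      then have "\<forall>\<^sub>F x in at s within {0..h}. norm (G x) \<le> k * K\<^sup>2 * \<bar>(x - s)\<^sup>2 * cot (k * (x - s))\<bar>"
        by (auto simp: eventually_at_filter)
      from Lim_null_comparison[OF this lim] show ?thesis
        by (simp add: continuous_within G_s)
    qed
  qed
  define G' where "G' x = k * cot (k * (x - c)) * (2 * f x * f' x) - k\<^sup>2 * (f x)\<^sup>2 / (sin (k * (x - c)))\<^sup>2" for x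
  have derivG: "(G has_real_derivative G' x) (at x)" if x: "0 < x" "x < h" "x \<noteq> c" for x
  proof -
    have "((\<lambda>x. cot (k * (x - c))) has_real_derivative - inverse ((sin (k * (x - c)))\<^sup>2) * k) (at x)"
      by (rule DERIV_chain2[of cot _ "\<lambda>x. k * (x - c)", OF DERIV_cot[OF sin_nz[OF x]]]) (auto intro!: derivative_eq_intros)
    from DERIV_mult[OF DERIV_cmult[OF this, of k] DERIV_power[OF deriv[OF x(1,2)], of 2]]
    show ?thesis
      unfolding G_def G'_def by (rule back_subst[where P = "\<lambda>D. (_ has_real_derivative D) _"])
        (simp add: field_simps power2_eq_square)
  qed
  have "(G' has_integral (G h - G 0)) {0..h}"
    using h contG derivG
    by (intro fundamental_theorem_of_calculus_interior_strong[of "{c}"])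
       (auto simp: has_real_derivative_iff_has_vector_derivative)
  moreover have "G h = G 0"
  proof -
    have "cot (k * (h - c)) = cot (k * (0 - c))"
      using k cot_add_of_sin_eq_0[of pi "- (k * c)"] by (simp add: right_diff_distrib algebra_simps)
    moreover have "(f h)\<^sup>2 = (f 0)\<^sup>2" using anti by (simp add: power2_eq_iff add_eq_0_iff)
    ultimately show ?thesis by (simp add: G_def)
  qed
  ultimately have G'_0: "(G' has_integral 0) {0..h}" by simp
  have int_f: "(\<lambda>x. (f x)\<^sup>2) integrable_on {0..h}"
    by (intro integrable_continuous_real continuous_intros cont)
  have "((\<lambda>x. (f' x)\<^sup>2 - k\<^sup>2 * (f x)\<^sup>2) has_integral
      (integral {0..h} (\<lambda>x. (f' x)\<^sup>2) - k\<^sup>2 * integral {0..h} (\<lambda>x. (f x)\<^sup>2))) {0..h}"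
    by (intro has_integral_diff has_integral_mult_right integrable_integral int int_f)
  then have energy: "((\<lambda>x. (f' x)\<^sup>2 - k\<^sup>2 * (f x)\<^sup>2) has_integral
      (integral {0..h} (\<lambda>x. (f' x)\<^sup>2) - k\<^sup>2 * integral {0..h} (\<lambda>x. (f x)\<^sup>2))) {0<..<h}"
    unfolding has_integral_Icc_iff_Ioo .
  have null: "(G' has_integral 0) {0<..<h}"
    using G'_0 unfolding has_integral_Icc_iff_Ioo .
  have le: "G' x \<le> (f' x)\<^sup>2 - k\<^sup>2 * (f x)\<^sup>2" if "x \<in> {0<..<h}" for x
  proof (cases "x = c")
    case True
    then show ?thesis by (simp add: G'_def c)
  next
    case False
    then have "sin (k * (x - c)) \<noteq> 0" using that sin_nz by auto
    then have "(cot (k * (x - c)))\<^sup>2 = 1 / (sin (k * (x - c)))\<^sup>2 - 1"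
      by (simp add: cot_def power_divide cos_squared_eq diff_divide_distrib)
    then have "(f' x)\<^sup>2 - k\<^sup>2 * (f x)\<^sup>2 - G' x = (f' x - k * cot (k * (x - c)) * f x)\<^sup>2"
      by (simp add: G'_def power2_diff power_mult_distrib) (simp add: algebra_simps)
    then show ?thesis by (metis diff_ge_0_iff_ge zero_le_power2)
  qed
  have "0 \<le> integral {0..h} (\<lambda>x. (f' x)\<^sup>2) - k\<^sup>2 * integral {0..h} (\<lambda>x. (f x)\<^sup>2)"
    using le by (rule has_integral_le[OF null energy])
  then show ?thesis
    using h by (simp add: k_def field_simps power_divide)
qed

text \<open>
  The primitive \<open>F\<close> of \<open>f\<close> vanishes at both ends, so \<open>antiperiodic_wirtinger\<close> bounds \<open>\<integral> F\<^sup>2\<close> by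
  \<open>(h / \<pi>)\<^sup>2 \<integral> f\<^sup>2\<close>.  Integration by parts gives \<open>\<integral> f\<^sup>2 = - \<integral> F f'\<close>, and the product is at most half of
  \<open>(h / \<pi>)\<^sup>2 f'\<^sup>2 + (\<pi> / h)\<^sup>2 F\<^sup>2\<close>.  The exceptional set \<open>S\<close> admits functions with kinks, such as a
  function that is continued by reflection.
\<close>

lemma zero_mean_wirtinger:
  fixes f f' :: "real \<Rightarrow> real"
  assumes h: "0 < h" and cont: "continuous_on {0..h} f" and S: "finite S"
    and deriv: "\<And>x. 0 < x \<Longrightarrow> x < h \<Longrightarrow> x \<notin> S \<Longrightarrow> (f has_real_derivative f' x) (at x)"
    and int': "f' integrable_on {0..h}"
    and int: "(\<lambda>x. (f' x)\<^sup>2) integrable_on {0..h}"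
    and zero: "integral {0..h} f = 0"
  shows "integral {0..h} (\<lambda>x. (f x)\<^sup>2) \<le> (h / pi)\<^sup>2 * integral {0..h} (\<lambda>x. (f' x)\<^sup>2)"
proof -
  define F where "F x = integral {0..x} f" for x
  have F_deriv: "(F has_real_derivative f x) (at x within {0..h})" if "x \<in> {0..h}" for x
    unfolding F_def using integral_has_real_derivative[OF cont that] .
  then have F_deriv': "(F has_real_derivative f x) (at x)" if "0 < x" "x < h" for x
    using that by (metis at_within_Icc_at atLeastAtMost_iff less_eq_real_def)
  have F_cont: "continuous_on {0..h} F"
    using F_deriv by (rule DERIV_continuous_on)
  have F_ends: "F 0 = 0" "F h = 0" using zero by (auto simp: F_def)
  have int_f: "(\<lambda>x. (f x)\<^sup>2) integrable_on {0..h}"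
    by (intro integrable_continuous_real continuous_intros cont)
  have int_F: "(\<lambda>x. (F x)\<^sup>2) integrable_on {0..h}"
    by (intro integrable_continuous_real continuous_intros F_cont)
  let ?A = "integral {0..h} (\<lambda>x. (f x)\<^sup>2)" and ?B = "integral {0..h} (\<lambda>x. (f' x)\<^sup>2)"
    and ?E = "integral {0..h} (\<lambda>x. (F x)\<^sup>2)"
  obtain K where K: "\<And>x. x \<in> {0..h} \<Longrightarrow> \<bar>f x\<bar> \<le> K"
    using compact_imp_bounded[OF compact_continuous_image[OF cont compact_Icc]]
    unfolding bounded_iff by (metis imageI real_norm_def)
  have FE: "?E \<le> (h / pi)\<^sup>2 * ?A"
    using F_ends K by (intro antiperiodic_wirtinger[where K = K, OF h F_cont F_deriv' _ int_f]) auto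
  have "((\<lambda>x. f' x * F x) has_integral - ?A) {0..h}"
  proof (rule integration_by_parts_interior_strong[OF bounded_bilinear_mult S _ cont F_cont])
    show "((\<lambda>x. f x * f x) has_integral f h * F h - f 0 * F 0 - - ?A) {0..h}"
      using integrable_integral[OF int_f] by (simp add: F_ends power2_eq_square)
  qed (use h deriv F_deriv' in \<open>auto simp: has_real_derivative_iff_has_vector_derivative\<close>)
  then have "((\<lambda>x. (h / pi)\<^sup>2 * (f' x)\<^sup>2 + 2 * (h / pi) * (pi / h) * (f' x * F x) + (pi / h)\<^sup>2 * (F x)\<^sup>2)
      has_integral (h / pi)\<^sup>2 * ?B + 2 * (h / pi) * (pi / h) * (- ?A) + (pi / h)\<^sup>2 * ?E) {0..h}"
    by (intro has_integral_add has_integral_mult_right integrable_integral int int_F)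
  then have "0 \<le> (h / pi)\<^sup>2 * ?B + 2 * (h / pi) * (pi / h) * (- ?A) + (pi / h)\<^sup>2 * ?E"
  proof (rule has_integral_nonneg)
    fix x
    have "(h / pi)\<^sup>2 * (f' x)\<^sup>2 + 2 * (h / pi) * (pi / h) * (f' x * F x) + (pi / h)\<^sup>2 * (F x)\<^sup>2
        = (h / pi * f' x + pi / h * F x)\<^sup>2"
      by (simp add: power2_sum power_mult_distrib power_divide)
    then show "0 \<le> (h / pi)\<^sup>2 * (f' x)\<^sup>2 + 2 * (h / pi) * (pi / h) * (f' x * F x) + (pi / h)\<^sup>2 * (F x)\<^sup>2"
      by simp
  qed
  then have "2 * ?A \<le> (h / pi)\<^sup>2 * ?B + (pi / h)\<^sup>2 * ?E" using h by simp
  also have "(pi / h)\<^sup>2 * ?E \<le> (pi / h)\<^sup>2 * ((h / pi)\<^sup>2 * ?A)"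
    by (intro mult_left_mono FE) auto
  also have "\<dots> = ?A" using h by (simp add: field_simps)
  finally show ?thesis by simp
qed

section \<open>Integration over the square and the triangle\<close>

definition right_triangle :: "real \<Rightarrow> (real \<times> real) set" where
  "right_triangle h = {(x, y). 0 < y \<and> y < x \<and> x < h}"

lemma open_right_triangle: "open (right_triangle h)"
proof -
  have "right_triangle h = {p. 0 < snd p} \<inter> {p. snd p < fst p} \<inter> {p. fst p < h}"
    by (auto simp: right_triangle_def)
  then show ?thesis by (auto intro!: open_Collect_less continuous_intros)
qed

lemma borel_right_triangle [measurable]: "right_triangle h \<in> sets borel"
  by (simp add: open_right_triangle)

lemma right_triangle_subset_square: "right_triangle h \<subseteq> {0..h} \<times> {0..h}"
  by (auto simp: right_triangle_def)

lemma bounded_right_triangle: "bounded (right_triangle h)"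
  by (rule bounded_subset[OF _ right_triangle_subset_square]) (simp add: bounded_Times)

lemma AE_lborel_hyperplane:
  fixes a :: "'a::euclidean_space"
  assumes "a \<noteq> 0"
  shows "AE x in lborel. a \<bullet> x \<noteq> b"
proof -
  have "{x. a \<bullet> x = b} \<in> null_sets lebesgue"
    using assms by (simp add: negligible_hyperplane flip: negligible_iff_null_sets)
  then have "{x. a \<bullet> x = b} \<in> null_sets lborel"
    by (simp add: null_sets_completion_iff closed_hyperplane borel_closed)
  then show ?thesis by (rule AE_I') auto
qed

lemma set_integrable_bounded_borel:
  fixes f :: "'a::euclidean_space \<Rightarrow> real"
  assumes "bounded S" "S \<in> sets borel" "f \<in> borel_measurable borel" "\<And>x. x \<in> S \<Longrightarrow> \<bar>f x\<bar> \<le> M"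
  shows "set_integrable lborel S f"
  unfolding set_integrable_def
  using assms emeasure_bounded_finite[of S]
  by (intro integrableI_bounded_set_indicator[where B = M]) (auto simp: less_top)

lemma continuous_bounded_on_compact:
  fixes f :: "'a::topological_space \<Rightarrow> real"
  assumes "compact S" "continuous_on S f"
  obtains M where "\<And>x. x \<in> S \<Longrightarrow> \<bar>f x\<bar> \<le> M"
  using compact_imp_bounded[OF compact_continuous_image[OF assms(2,1)]]
  unfolding bounded_iff by (metis imageI real_norm_def)

lemma iterated_integral_square:
  fixes F :: "real \<times> real \<Rightarrow> real"
  assumes F: "F \<in> borel_measurable borel" and bd: "\<And>p. p \<in> {a..b} \<times> {a..b} \<Longrightarrow> \<bar>F p\<bar> \<le> M"
  shows "(LINT x:{a..b}|lborel. LINT y:{a..b}|lborel. F (x, y)) = (LINT p:{a..b} \<times> {a..b}|lborel. F p)"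
    and "(LINT y:{a..b}|lborel. LINT x:{a..b}|lborel. F (x, y)) = (LINT p:{a..b} \<times> {a..b}|lborel. F p)"
    and "set_integrable lborel {a..b} (\<lambda>x. LINT y:{a..b}|lborel. F (x, y))"
    and "set_integrable lborel {a..b} (\<lambda>y. LINT x:{a..b}|lborel. F (x, y))"
proof -
  define G where "G p = indicator ({a..b} \<times> {a..b}) p *\<^sub>R F p" for p
  have G: "integrable (lborel \<Otimes>\<^sub>M lborel) (case_prod (\<lambda>x y. G (x, y)))"
    using set_integrable_bounded_borel[OF _ _ F bd, of "{a..b} \<times> {a..b}"]
    unfolding lborel_prod set_integrable_def G_def
    by (simp add: bounded_Times borel_closed closed_Times split_beta')
  have eq: "(\<integral>y. G (x, y) \<partial>lborel) = indicator {a..b} x *\<^sub>R (LINT y:{a..b}|lborel. F (x, y))"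
    and eq': "(\<integral>x. G (x, y) \<partial>lborel) = indicator {a..b} y *\<^sub>R (LINT x:{a..b}|lborel. F (x, y))" for x y
    by (auto simp: G_def set_lebesgue_integral_def indicator_times mult.assoc mult.left_commute
        split: split_indicator)
  have "(\<integral>x. (\<integral>y. G (x, y) \<partial>lborel) \<partial>lborel) = (\<integral>p. G p \<partial>(lborel \<Otimes>\<^sub>M lborel))"
    using lborel_pair.integral_fst[OF G] by simp
  then show "(LINT x:{a..b}|lborel. LINT y:{a..b}|lborel. F (x, y)) = (LINT p:{a..b} \<times> {a..b}|lborel. F p)"
    unfolding eq lborel_prod by (simp add: G_def set_lebesgue_integral_def)
  have "(\<integral>y. (\<integral>x. G (x, y) \<partial>lborel) \<partial>lborel) = (\<integral>p. G p \<partial>(lborel \<Otimes>\<^sub>M lborel))"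
    using lborel_pair.integral_snd[OF G] by simp
  then show "(LINT y:{a..b}|lborel. LINT x:{a..b}|lborel. F (x, y)) = (LINT p:{a..b} \<times> {a..b}|lborel. F p)"
    unfolding eq' lborel_prod by (simp add: G_def set_lebesgue_integral_def)
  show "set_integrable lborel {a..b} (\<lambda>x. LINT y:{a..b}|lborel. F (x, y))"
    using lborel_pair.integrable_fst[OF G] unfolding eq set_integrable_def by simp
  show "set_integrable lborel {a..b} (\<lambda>y. LINT x:{a..b}|lborel. F (x, y))"
    using lborel_pair.integrable_snd[OF G] unfolding eq' set_integrable_def by simp
qed

text \<open>
  The two triangles cut off by the diagonal are mirror images, and the remaining part of the square is
  contained in five lines.
\<close>

lemma integral_square_fold:
  fixes E F :: "real \<times> real \<Rightarrow> real"
  assumes E: "E \<in> borel_measurable borel" "\<And>p. p \<in> {0..h} \<times> {0..h} \<Longrightarrow> \<bar>E p\<bar> \<le> M"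
    and F: "F \<in> borel_measurable borel" "\<And>p. p \<in> {0..h} \<times> {0..h} \<Longrightarrow> \<bar>F p\<bar> \<le> M"
  shows "(LINT p:{0..h} \<times> {0..h}|lborel. if fst p < snd p then F (snd p, fst p) else E p)
    = (LINT p:right_triangle h|lborel. F p) + (LINT p:right_triangle h|lborel. E p)"
proof -
  let ?S = "{0..h} \<times> {0..h}"
  define F' where "F' p = indicator (right_triangle h) p *\<^sub>R F p" for p
  define E' where "E' p = indicator (right_triangle h) p *\<^sub>R E p" for p
  have meas: "F' \<in> borel_measurable borel" "E' \<in> borel_measurable borel"
    unfolding F'_def E'_def using E F by measurable
  have tri: "set_integrable lborel (right_triangle h) F" "set_integrable lborel (right_triangle h) E"
    using E F right_triangle_subset_square
    by (intro set_integrable_bounded_borel[where M = M] bounded_right_triangle borel_right_triangle; blast)+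
  then have int: "integrable (lborel \<Otimes>\<^sub>M lborel) F'" "integrable lborel E'"
    unfolding lborel_prod by (simp_all add: set_integrable_def F'_def[abs_def] E'_def[abs_def])
  have int': "integrable lborel (\<lambda>p. F' (snd p, fst p))"
    using lborel_pair.integrable_product_swap[OF int(1)] unfolding lborel_prod by (simp add: split_beta')
  have swap: "(\<integral>p. F' (snd p, fst p) \<partial>lborel) = (\<integral>p. F' p \<partial>lborel)"
    using lborel_pair.integral_product_swap[of F'] meas unfolding lborel_prod by (simp add: split_beta')
  have "(LINT p:?S|lborel. if fst p < snd p then F (snd p, fst p) else E p)
      = (\<integral>p. F' (snd p, fst p) + E' p \<partial>lborel)"
    unfolding set_lebesgue_integral_def
  proof (rule integral_cong_AE)
    have "(\<lambda>p::real \<times> real. (snd p, fst p)) \<in> measurable borel borel"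
      by (intro borel_measurable_continuous_onI continuous_intros)
    note [measurable] = measurable_compose[OF this F(1)] measurable_compose[OF this meas(1)]
    note [measurable] = E(1) meas
    have [measurable]: "Measurable.pred borel (\<lambda>p::real \<times> real. fst p < snd p)"
      by (auto intro!: pred_Collect_borel borel_open open_Collect_less continuous_intros simp: pred_def)
    have [measurable]: "?S \<in> sets borel" by (simp add: borel_closed closed_Times)
    show "(\<lambda>p. indicator ?S p *\<^sub>R (if fst p < snd p then F (snd p, fst p) else E p)) \<in> borel_measurable lborel"
      by measurable
    show "(\<lambda>p. F' (snd p, fst p) + E' p) \<in> borel_measurable lborel"
      by measurable
    have "AE p in lborel. (1::real, - 1::real) \<bullet> p \<noteq> 0" "AE p in lborel. (1::real, 0::real) \<bullet> p \<noteq> 0"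
      "AE p in lborel. (1::real, 0::real) \<bullet> p \<noteq> h" "AE p in lborel. (0::real, 1::real) \<bullet> p \<noteq> 0"
      "AE p in lborel. (0::real, 1::real) \<bullet> p \<noteq> h"
      by (auto intro!: AE_lborel_hyperplane simp: zero_prod_def)
    then show "AE p in lborel. indicator ?S p *\<^sub>R (if fst p < snd p then F (snd p, fst p) else E p)
        = F' (snd p, fst p) + E' p"
      by eventually_elim
        (auto simp: F'_def E'_def inner_prod_def right_triangle_def mem_Times_iff split: split_indicator)
  qed
  also have "\<dots> = (\<integral>p. F' (snd p, fst p) \<partial>lborel) + (\<integral>p. E' p \<partial>lborel)"
    by (intro Bochner_Integration.integral_add int int')
  finally show ?thesis
    unfolding swap by (simp add: F'_def[abs_def] E'_def[abs_def] set_lebesgue_integral_def)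
qed

section \<open>The Poincare inequality for continuously differentiable functions\<close>

text \<open>
  The variable \<open>y\<close> occurs as a parameter and as the upper limit.  The two-variable function
  \<open>(z, a) \<mapsto> \<integral>\<^sub>0\<^sup>a g z\<close> is differentiable by the Leibniz rule and the fundamental theorem of calculus, and
  the claim is the chain rule along the diagonal.
\<close>

lemma has_real_derivative_integral_upto_self:
  fixes g g1 :: "real \<Rightarrow> real \<Rightarrow> real"
  assumes y: "0 < y" "y < h"
    and deriv: "\<And>y x. ((\<lambda>y. g y x) has_real_derivative g1 y x) (at y)"
    and cont: "continuous_on UNIV (\<lambda>(y, x). g y x)" and cont1: "continuous_on UNIV (\<lambda>(y, x). g1 y x)"
  shows "((\<lambda>y. integral {0..y} (g y)) has_real_derivative (integral {0..y} (g1 y) + g y y)) (at y)"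
proof -
  have cont': "continuous_on UNIV (\<lambda>p. g (fst p) (snd p))"
    using cont by (simp add: split_beta')
  have cont_g: "continuous_on S (g y)" for S y
  proof -
    have "continuous_on S (Pair y)" by (intro continuous_intros)
    from continuous_on_compose2[OF cont' this] show ?thesis by simp
  qed
  have outer: "((\<lambda>z. integral {0..y} (g z)) has_real_derivative integral {0..y} (g1 y)) (at y)"
    by (rule leibniz_rule_field_derivative[of UNIV 0 y g g1 y, unfolded cbox_interval])
      (auto intro: deriv cont_g integrable_continuous_real continuous_on_subset[OF cont1])
  have inner: "((\<lambda>a. integral {0..a} (g z)) has_derivative blinfun_apply (blinfun_mult_right (g z a)))
      (at a within {0<..<h})" if "a \<in> {0<..<h}" for z a
  proof -
    have "((\<lambda>a. integral {0..a} (g z)) has_real_derivative g z a) (at a within {0..h})"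
      using that by (intro integral_has_real_derivative cont_g) auto
    then have "((\<lambda>a. integral {0..a} (g z)) has_real_derivative g z a) (at a within {0<..<h})"
      by (rule has_field_derivative_subset) auto
    then show ?thesis by (simp add: has_field_derivative_def)
  qed
  have "((\<lambda>(z, a). integral {0..a} (g z)) has_derivative
      (\<lambda>(tz, ta). integral {0..y} (g1 y) * tz + blinfun_apply (blinfun_mult_right (g y y)) ta))
      (at (y, y) within UNIV \<times> {0<..<h})"
  proof (rule has_derivative_partialsI[where fy = "\<lambda>z a. blinfun_mult_right (g z a)"])
    show "((\<lambda>z. integral {0..y} (g z)) has_derivative (*) (integral {0..y} (g1 y))) (at y)"
      using outer by (simp add: has_field_derivative_def)
    have "continuous_on UNIV (\<lambda>p. blinfun_mult_right (g (fst p) (snd p)))"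
      by (rule bounded_linear.continuous_on[OF bounded_linear_blinfun_mult_right cont'])
    then have "isCont (\<lambda>p. blinfun_mult_right (g (fst p) (snd p))) (y, y)"
      by (simp add: continuous_on_eq_continuous_at)
    then show "continuous (at (y, y) within UNIV \<times> {0<..<h}) (\<lambda>(z, a). blinfun_mult_right (g z a))"
      unfolding split_beta' by (rule continuous_at_imp_continuous_at_within)
    show "((\<lambda>a. integral {0..a} (g z)) has_derivative blinfun_apply (blinfun_mult_right (g z a)))
      (at a within {0<..<h})" if "a \<in> {0<..<h}" for z a
      using that by (rule inner)
    show "y \<in> {0<..<h}" "convex {0<..<h}" using y by auto
  qed
  moreover have "at (y, y) within UNIV \<times> {0<..<h} = at (y, y)"
    using y by (intro at_within_open open_Times) auto
  ultimately have "((\<lambda>(z, a). integral {0..a} (g z)) has_derivative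
      (\<lambda>(tz, ta). integral {0..y} (g1 y) * tz + g y y * ta)) (at (y, y))"
    by simp
  moreover have "((\<lambda>y. (y, y)) has_derivative (\<lambda>t. (t, t))) (at y)"
    by (intro derivative_intros)
  ultimately have "((\<lambda>y. integral {0..y} (g y)) has_derivative
      (\<lambda>t. integral {0..y} (g1 y) * t + g y y * t)) (at y)"
    using has_derivative_compose[of "\<lambda>y. (y, y)" "\<lambda>t. (t, t)" y UNIV "\<lambda>(z, a). integral {0..a} (g z)"
      "\<lambda>(tz, ta). integral {0..y} (g1 y) * tz + g y y * ta"] by simp
  then show ?thesis
    by (simp add: has_field_derivative_def distrib_right[symmetric])
qed

locale C1_triangle =
  fixes h :: real and u u1 u2 :: "real \<times> real \<Rightarrow> real"
  assumes h: "0 < h"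
    and deriv_u: "(u has_derivative (\<lambda>v. fst v * u1 p + snd v * u2 p)) (at p)"
    and cont_u1: "continuous_on UNIV u1" and cont_u2: "continuous_on UNIV u2"
begin

abbreviation square :: "(real \<times> real) set" where
  "square \<equiv> {0..h} \<times> {0..h}"

definition fold_u :: "real \<Rightarrow> real \<Rightarrow> real" where
  "fold_u x y = u (max x y, min x y)"

text \<open>
  The partial derivative of \<open>fold_u\<close> in its first argument, off the diagonal.  By symmetry,
  \<open>fold_u_x y x\<close> is the partial derivative in the second argument at \<open>(x, y)\<close>.
\<close>

definition fold_u_x :: "real \<Rightarrow> real \<Rightarrow> real" where
  "fold_u_x x y = (if x < y then u2 (y, x) else u1 (x, y))"

definition row_mean :: "real \<Rightarrow> real" where
  "row_mean y = (1 / h) * (LINT x:{0..h}|lborel. fold_u x y)"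

definition row_mean' :: "real \<Rightarrow> real" where
  "row_mean' y = (1 / h) * (LINT x:{0..h}|lborel. fold_u_x y x)"

lemma cont_u: "continuous_on UNIV u"
  using has_derivative_continuous[OF deriv_u] by (simp add: continuous_on_eq_continuous_at)

lemma cont_u_compose: "continuous_on S a \<Longrightarrow> continuous_on S b \<Longrightarrow> continuous_on S (\<lambda>x. u (a x, b x))"
  and cont_u1_compose: "continuous_on S a \<Longrightarrow> continuous_on S b \<Longrightarrow> continuous_on S (\<lambda>x. u1 (a x, b x))"
  and cont_u2_compose: "continuous_on S a \<Longrightarrow> continuous_on S b \<Longrightarrow> continuous_on S (\<lambda>x. u2 (a x, b x))"
  by (auto intro!: continuous_on_compose2[OF cont_u] continuous_on_compose2[OF cont_u1]
      continuous_on_compose2[OF cont_u2] continuous_on_Pair)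

lemma DERIV_u_fst: "((\<lambda>x. u (x, y)) has_real_derivative u1 (x, y)) (at x)"
proof -
  have "((\<lambda>x. (x, y)) has_derivative (\<lambda>t. (t, 0))) (at x)" by (intro derivative_intros)
  from has_derivative_compose[OF this deriv_u] show ?thesis
    by (simp add: has_field_derivative_def mult_commute_abs)
qed

lemma DERIV_u_snd: "((\<lambda>y. u (x, y)) has_real_derivative u2 (x, y)) (at y)"
proof -
  have "((\<lambda>y. (x, y)) has_derivative (\<lambda>t. (0, t))) (at y)" by (intro derivative_intros)
  from has_derivative_compose[OF this deriv_u] show ?thesis
    by (simp add: has_field_derivative_def mult_commute_abs)
qed

lemma bounded_on_square:
  obtains M where "\<And>p. p \<in> square \<Longrightarrow> \<bar>u p\<bar> \<le> M" "\<And>p. p \<in> square \<Longrightarrow> \<bar>u1 p\<bar> \<le> M"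
    "\<And>p. p \<in> square \<Longrightarrow> \<bar>u2 p\<bar> \<le> M"
proof -
  have c: "compact square" by (simp add: compact_Times)
  obtain M0 where "\<And>p. p \<in> square \<Longrightarrow> \<bar>u p\<bar> \<le> M0"
    using continuous_bounded_on_compact[OF c] cont_u continuous_on_subset by (metis subset_UNIV)
  moreover obtain M1 where "\<And>p. p \<in> square \<Longrightarrow> \<bar>u1 p\<bar> \<le> M1"
    using continuous_bounded_on_compact[OF c] cont_u1 continuous_on_subset by (metis subset_UNIV)
  moreover obtain M2 where "\<And>p. p \<in> square \<Longrightarrow> \<bar>u2 p\<bar> \<le> M2"
    using continuous_bounded_on_compact[OF c] cont_u2 continuous_on_subset by (metis subset_UNIV)
  ultimately show ?thesis
    by (intro that[of "max M0 (max M1 M2)"]) (simp_all add: le_max_iff_disj)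
qed

lemma cont_fold_u: "continuous_on UNIV (\<lambda>p. fold_u (fst p) (snd p))"
  unfolding fold_u_def by (intro cont_u_compose continuous_intros)

lemma cont_fold_u_slice: "continuous_on S (\<lambda>x. fold_u x y)"
  unfolding fold_u_def by (intro cont_u_compose continuous_intros)

lemma borel_fold_u_x: "(\<lambda>p. fold_u_x (fst p) (snd p)) \<in> borel_measurable borel"
proof -
  have [measurable]: "(\<lambda>p. u2 (snd p, fst p)) \<in> borel_measurable borel" "u1 \<in> borel_measurable borel"
    by (auto intro!: borel_measurable_continuous_onI cont_u1 cont_u2_compose continuous_intros)
  have [measurable]: "Measurable.pred borel (\<lambda>p::real \<times> real. fst p < snd p)"
    by (auto intro!: borel_open open_Collect_less continuous_intros simp: pred_def)
  show ?thesis unfolding fold_u_x_def prod.collapse by measurable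
qed

lemma fold_u_x_bounded:
  assumes "\<And>p. p \<in> square \<Longrightarrow> \<bar>u1 p\<bar> \<le> M" "\<And>p. p \<in> square \<Longrightarrow> \<bar>u2 p\<bar> \<le> M"
    and "x \<in> {0..h}" "y \<in> {0..h}"
  shows "\<bar>fold_u_x x y\<bar> \<le> M"
  using assms by (auto simp: fold_u_x_def)

lemma borel_fold_u_x_slices:
  "(\<lambda>x. fold_u_x x y) \<in> borel_measurable borel" "(\<lambda>x. fold_u_x y x) \<in> borel_measurable borel"
proof -
  have "(\<lambda>x::real. (x, y)) \<in> measurable borel borel" "(\<lambda>x::real. (y, x)) \<in> measurable borel borel"
    by (intro borel_measurable_continuous_onI continuous_intros)+
  from this[THEN measurable_compose[OF _ borel_fold_u_x]]
  show "(\<lambda>x. fold_u_x x y) \<in> borel_measurable borel" "(\<lambda>x. fold_u_x y x) \<in> borel_measurable borel"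
    by simp_all
qed

lemma slice_integrable:
  assumes "y \<in> {0..h}"
  shows "set_integrable lborel {0..h} (\<lambda>x. fold_u x y)"
    and "set_integrable lborel {0..h} (\<lambda>x. (fold_u x y)\<^sup>2)"
    and "set_integrable lborel {0..h} (\<lambda>x. fold_u_x x y)"
    and "set_integrable lborel {0..h} (\<lambda>x. (fold_u_x x y)\<^sup>2)"
    and "set_integrable lborel {0..h} (\<lambda>x. fold_u_x y x)"
    and "set_integrable lborel {0..h} (\<lambda>x. (fold_u_x y x)\<^sup>2)"
proof -
  show "set_integrable lborel {0..h} (\<lambda>x. fold_u x y)"
    "set_integrable lborel {0..h} (\<lambda>x. (fold_u x y)\<^sup>2)"
    by (auto intro!: borel_integrable_atLeastAtMost' continuous_intros cont_fold_u_slice)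
  obtain M where M: "\<And>p. p \<in> square \<Longrightarrow> \<bar>u1 p\<bar> \<le> M" "\<And>p. p \<in> square \<Longrightarrow> \<bar>u2 p\<bar> \<le> M"
    by (rule bounded_on_square) blast
  have b: "\<bar>fold_u_x x z\<bar> \<le> M" "(fold_u_x x z)\<^sup>2 \<le> M\<^sup>2" if "x \<in> {0..h}" "z \<in> {0..h}" for x z
    using fold_u_x_bounded[OF M that] by (simp_all add: abs_le_square_iff[symmetric])
  note [measurable] = borel_fold_u_x_slices
  show "set_integrable lborel {0..h} (\<lambda>x. fold_u_x x y)" "set_integrable lborel {0..h} (\<lambda>x. fold_u_x y x)"
    using assms by (auto intro!: set_integrable_bounded_borel[where M = M] b)
  show "set_integrable lborel {0..h} (\<lambda>x. (fold_u_x x y)\<^sup>2)" "set_integrable lborel {0..h} (\<lambda>x. (fold_u_x y x)\<^sup>2)"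
    using assms by (auto intro!: set_integrable_bounded_borel[where M = "M\<^sup>2"] b)
qed

lemma slice_integrals:
  assumes "y \<in> {0..h}"
  shows "integral {0..h} (\<lambda>x. fold_u x y) = (LINT x:{0..h}|lborel. fold_u x y)"
    and "integral {0..h} (\<lambda>x. (fold_u_x x y)\<^sup>2) = (LINT x:{0..h}|lborel. (fold_u_x x y)\<^sup>2)"
    and "integral {0..h} (\<lambda>x. fold_u_x y x) = (LINT x:{0..h}|lborel. fold_u_x y x)"
  using slice_integrable[OF assms] by (simp_all add: set_borel_integral_eq_integral)

lemma DERIV_fold_u:
  assumes "x \<noteq> y"
  shows "((\<lambda>x. fold_u x y) has_real_derivative fold_u_x x y) (at x)"
proof (cases "x < y")
  case True
  have "((\<lambda>x. u (y, x)) has_real_derivative fold_u_x x y) (at x)"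
    using True DERIV_u_snd by (simp add: fold_u_x_def)
  then show ?thesis
    by (rule has_field_derivative_transform_within_open[where S = "{..<y}"])
      (use True in \<open>auto simp: fold_u_def\<close>)
next
  case False
  have "((\<lambda>x. u (x, y)) has_real_derivative fold_u_x x y) (at x)"
    using False DERIV_u_fst by (simp add: fold_u_x_def)
  then show ?thesis
    by (rule has_field_derivative_transform_within_open[where S = "{y<..}"])
      (use False assms in \<open>auto simp: fold_u_def\<close>)
qed

lemma row_mean_split:
  assumes "z \<in> {0..h}"
  shows "row_mean z = (1 / h) * (integral {0..z} (\<lambda>x. u (z, x)) +
    (integral {0..h} (\<lambda>x. u (x, z)) - integral {0..z} (\<lambda>x. u (x, z))))"
proof -
  have int: "(\<lambda>x. u (x, z)) integrable_on {0..h}" "(\<lambda>x. fold_u x z) integrable_on {0..h}"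
    by (intro integrable_continuous_real cont_u_compose cont_fold_u_slice continuous_intros)+
  have "integral {0..h} (\<lambda>x. fold_u x z)
      = integral {0..z} (\<lambda>x. fold_u x z) + integral {z..h} (\<lambda>x. fold_u x z)"
    using assms int by (intro Henstock_Kurzweil_Integration.integral_combine[symmetric]) auto
  also have "integral {0..z} (\<lambda>x. fold_u x z) = integral {0..z} (\<lambda>x. u (z, x))"
    by (intro Henstock_Kurzweil_Integration.integral_cong) (auto simp: fold_u_def max_def min_def)
  also have "integral {z..h} (\<lambda>x. fold_u x z) = integral {z..h} (\<lambda>x. u (x, z))"
    by (intro Henstock_Kurzweil_Integration.integral_cong) (auto simp: fold_u_def max_def min_def)
  also have "integral {z..h} (\<lambda>x. u (x, z)) = integral {0..h} (\<lambda>x. u (x, z)) - integral {0..z} (\<lambda>x. u (x, z))"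
    using assms int Henstock_Kurzweil_Integration.integral_combine[of 0 z h "\<lambda>x. u (x, z)"] by simp
  finally show ?thesis
    unfolding row_mean_def slice_integrals(1)[OF assms, symmetric] by simp
qed

lemma row_mean'_split:
  assumes "y \<in> {0..h}"
  shows "row_mean' y = (1 / h) * (integral {0..y} (\<lambda>x. u1 (y, x)) +
    (integral {0..h} (\<lambda>x. u2 (x, y)) - integral {0..y} (\<lambda>x. u2 (x, y))))"
proof -
  have int: "(\<lambda>x. u2 (x, y)) integrable_on {0..h}"
    by (intro integrable_continuous_real cont_u2_compose continuous_intros)
  have int': "(\<lambda>x. fold_u_x y x) integrable_on {0..h}"
    using slice_integrable(5)[OF assms] by (rule set_borel_integral_eq_integral)
  have "integral {0..h} (\<lambda>x. fold_u_x y x)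
      = integral {0..y} (\<lambda>x. fold_u_x y x) + integral {y..h} (\<lambda>x. fold_u_x y x)"
    using assms int' by (intro Henstock_Kurzweil_Integration.integral_combine[symmetric]) auto
  also have "integral {0..y} (\<lambda>x. fold_u_x y x) = integral {0..y} (\<lambda>x. u1 (y, x))"
    by (intro Henstock_Kurzweil_Integration.integral_cong) (auto simp: fold_u_x_def)
  also have "integral {y..h} (\<lambda>x. fold_u_x y x) = integral {y..h} (\<lambda>x. u2 (x, y))"
    by (rule integral_spike[of "{y}"]) (auto simp: fold_u_x_def)
  also have "integral {y..h} (\<lambda>x. u2 (x, y)) = integral {0..h} (\<lambda>x. u2 (x, y)) - integral {0..y} (\<lambda>x. u2 (x, y))"
    using assms int Henstock_Kurzweil_Integration.integral_combine[of 0 y h "\<lambda>x. u2 (x, y)"] by simp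
  finally show ?thesis
    unfolding row_mean'_def slice_integrals(3)[OF assms, symmetric] by simp
qed

text \<open>
  The row at height \<open>y\<close> crosses the diagonal at \<open>x = y\<close>.  Differentiating the integrals over the two
  parts produces the boundary terms \<open>u (y, y)\<close> and \<open>- u (y, y)\<close>.
\<close>

lemma DERIV_row_mean:
  assumes y: "0 < y" "y < h"
  shows "(row_mean has_real_derivative row_mean' y) (at y)"
proof -
  have cont: "continuous_on UNIV (\<lambda>(y, x). u (y, x))" "continuous_on UNIV (\<lambda>(y, x). u1 (y, x))"
    "continuous_on UNIV (\<lambda>(y, x). u (x, y))" "continuous_on UNIV (\<lambda>(y, x). u2 (x, y))"
    unfolding split_beta' by (intro cont_u_compose cont_u1_compose cont_u2_compose continuous_intros)+
  have A: "((\<lambda>y. integral {0..y} (\<lambda>x. u (y, x))) has_real_derivative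
      integral {0..y} (\<lambda>x. u1 (y, x)) + u (y, y)) (at y)"
    by (rule has_real_derivative_integral_upto_self[OF y DERIV_u_fst cont(1,2)])
  have B: "((\<lambda>y. integral {0..y} (\<lambda>x. u (x, y))) has_real_derivative
      integral {0..y} (\<lambda>x. u2 (x, y)) + u (y, y)) (at y)"
    by (rule has_real_derivative_integral_upto_self[OF y DERIV_u_snd cont(3,4)])
  have C: "((\<lambda>y. integral {0..h} (\<lambda>x. u (x, y))) has_real_derivative
      integral {0..h} (\<lambda>x. u2 (x, y))) (at y)"
    by (rule leibniz_rule_field_derivative[of UNIV 0 h "\<lambda>y x. u (x, y)" "\<lambda>y x. u2 (x, y)" y,
          unfolded cbox_interval])
      (auto intro!: DERIV_u_snd integrable_continuous_real continuous_on_subset[OF cont(4)]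
        cont_u_compose continuous_intros)
  have "((\<lambda>z. (1 / h) * (integral {0..z} (\<lambda>x. u (z, x)) +
      (integral {0..h} (\<lambda>x. u (x, z)) - integral {0..z} (\<lambda>x. u (x, z))))) has_real_derivative
      (1 / h) * (integral {0..y} (\<lambda>x. u1 (y, x)) + u (y, y) +
      (integral {0..h} (\<lambda>x. u2 (x, y)) - (integral {0..y} (\<lambda>x. u2 (x, y)) + u (y, y))))) (at y)"
    by (intro DERIV_cmult DERIV_add DERIV_diff A B C)
  then have "((\<lambda>z. (1 / h) * (integral {0..z} (\<lambda>x. u (z, x)) +
      (integral {0..h} (\<lambda>x. u (x, z)) - integral {0..z} (\<lambda>x. u (x, z))))) has_real_derivative
      row_mean' y) (at y)"
    using y by (simp add: row_mean'_split)
  then show ?thesis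
    by (rule has_field_derivative_transform_within_open[where S = "{0<..<h}"])
      (use y row_mean_split in auto)
qed

lemma cont_row_mean: "continuous_on {0..h} row_mean"
proof -
  have "continuous_on UNIV (\<lambda>(y, x). fold_u x y)"
    unfolding split_beta' fold_u_def by (intro cont_u_compose continuous_intros)
  then have "continuous_on ({0..h} \<times> cbox 0 h) (\<lambda>(y, x). fold_u x y)"
    by (rule continuous_on_subset) simp
  from integral_continuous_on_param[OF this]
  have "continuous_on {0..h} (\<lambda>y. (1 / h) * integral {0..h} (\<lambda>x. fold_u x y))"
    by (intro continuous_intros) simp
  then show ?thesis
    by (rule continuous_on_cong[THEN iffD1, rotated 2]) (simp_all add: row_mean_def slice_integrals)
qed

text \<open>
  Jensen's inequality: a variance is nonnegative.
\<close>

lemma row_mean'_sq_le: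
  assumes y: "y \<in> {0..h}"
  shows "h * (row_mean' y)\<^sup>2 \<le> (LINT x:{0..h}|lborel. (fold_u_x y x)\<^sup>2)"
proof -
  define m where "m = row_mean' y"
  let ?D = "\<lambda>x. fold_u_x y x"
  have D: "(?D has_integral (h * m)) {0..h}"
    using h set_borel_integral_eq_integral[OF slice_integrable(5)[OF y]]
    by (simp add: has_integral_iff m_def row_mean'_def)
  have D2: "((\<lambda>x. (?D x)\<^sup>2) has_integral (LINT x:{0..h}|lborel. (?D x)\<^sup>2)) {0..h}"
    using set_borel_integral_eq_integral[OF slice_integrable(6)[OF y]] by (simp add: has_integral_iff)
  have const: "((\<lambda>x. m\<^sup>2) has_integral (h * m\<^sup>2)) {0..h}"
    using has_integral_const[of "m\<^sup>2" 0 h] h by simp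
  have "((\<lambda>x. (?D x)\<^sup>2 - 2 * m * ?D x + m\<^sup>2) has_integral
      ((LINT x:{0..h}|lborel. (?D x)\<^sup>2) - 2 * m * (h * m) + h * m\<^sup>2)) {0..h}"
    by (intro has_integral_add has_integral_diff has_integral_mult_right D D2 const)
  then have "0 \<le> (LINT x:{0..h}|lborel. (?D x)\<^sup>2) - 2 * m * (h * m) + h * m\<^sup>2"
  proof (rule has_integral_nonneg)
    fix x
    have "(?D x)\<^sup>2 - 2 * m * ?D x + m\<^sup>2 = (?D x - m)\<^sup>2" by (simp add: power2_diff algebra_simps)
    then show "0 \<le> (?D x)\<^sup>2 - 2 * m * ?D x + m\<^sup>2" by simp
  qed
  then show ?thesis by (simp add: m_def power2_eq_square algebra_simps)
qed

text \<open>
  Subtracting the mean value from a row leaves a function with mean value zero and a kink on the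
  diagonal.
\<close>

lemma row_wirtinger:
  assumes y: "y \<in> {0..h}"
  shows "(LINT x:{0..h}|lborel. (fold_u x y)\<^sup>2)
    \<le> h * (row_mean y)\<^sup>2 + (h / pi)\<^sup>2 * (LINT x:{0..h}|lborel. (fold_u_x x y)\<^sup>2)"
proof -
  define m where "m = row_mean y"
  let ?W = "\<lambda>x. fold_u x y"
  have W: "(?W has_integral (h * m)) {0..h}"
    using h set_borel_integral_eq_integral[OF slice_integrable(1)[OF y]]
    by (simp add: has_integral_iff m_def row_mean_def)
  have W2: "((\<lambda>x. (?W x)\<^sup>2) has_integral (LINT x:{0..h}|lborel. (?W x)\<^sup>2)) {0..h}"
    using set_borel_integral_eq_integral[OF slice_integrable(2)[OF y]] by (simp add: has_integral_iff)
  have const: "((\<lambda>x. c) has_integral (h * c)) {0..h}" for c :: real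
    using has_integral_const[of c 0 h] h by simp
  have "((\<lambda>x. (?W x)\<^sup>2 - 2 * m * ?W x + m\<^sup>2) has_integral
      ((LINT x:{0..h}|lborel. (?W x)\<^sup>2) - 2 * m * (h * m) + h * m\<^sup>2)) {0..h}"
    by (intro has_integral_add has_integral_diff has_integral_mult_right W W2 const)
  moreover have "(\<lambda>x. (?W x)\<^sup>2 - 2 * m * ?W x + m\<^sup>2) = (\<lambda>x. (?W x - m)\<^sup>2)"
    by (simp add: power2_diff algebra_simps)
  ultimately have "integral {0..h} (\<lambda>x. (?W x - m)\<^sup>2) = (LINT x:{0..h}|lborel. (?W x)\<^sup>2) - h * m\<^sup>2"
    by (simp add: has_integral_iff power2_eq_square algebra_simps)
  moreover have "integral {0..h} (\<lambda>x. (?W x - m)\<^sup>2) \<le> (h / pi)\<^sup>2 * integral {0..h} (\<lambda>x. (fold_u_x x y)\<^sup>2)"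
  proof (rule zero_mean_wirtinger[OF h, of _ "{y}"])
    show "continuous_on {0..h} (\<lambda>x. ?W x - m)"
      by (intro continuous_intros cont_fold_u_slice)
    show "((\<lambda>x. ?W x - m) has_real_derivative fold_u_x x y) (at x)" if "x \<notin> {y}" for x
      using DERIV_diff[OF DERIV_fold_u[of x y] DERIV_const[of m]] that by simp
    show "(\<lambda>x. fold_u_x x y) integrable_on {0..h}" "(\<lambda>x. (fold_u_x x y)\<^sup>2) integrable_on {0..h}"
      using slice_integrable(3,4)[OF y] by (auto dest: set_borel_integral_eq_integral(1))
    show "integral {0..h} (\<lambda>x. ?W x - m) = 0"
      using has_integral_diff[OF W const[of m]] by (simp add: has_integral_iff)
  qed simp
  ultimately show ?thesis
    unfolding slice_integrals(2)[OF y] m_def by linarith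
qed

text \<open>
  Integrating \<open>row_wirtinger\<close> over \<open>y\<close> leaves the integral of \<open>(row_mean y)\<^sup>2\<close>, to which the
  antiperiodic inequality applies: the hypothesis says that \<open>row_mean 0 + row_mean h = 0\<close>.  Both partial
  derivatives of \<open>fold_u\<close> have the same integral of squares over the square.
\<close>

lemma triangle_poincare:
  assumes mean: "integral {0..h} (\<lambda>t. u (h, t)) + integral {0..h} (\<lambda>t. u (t, 0)) = 0"
  shows "(LINT p:right_triangle h|lborel. (u p)\<^sup>2)
    \<le> (h / pi)\<^sup>2 * (LINT p:right_triangle h|lborel. (u1 p)\<^sup>2 + (u2 p)\<^sup>2)"
proof -
  obtain M where M: "\<And>p. p \<in> square \<Longrightarrow> \<bar>u p\<bar> \<le> M" "\<And>p. p \<in> square \<Longrightarrow> \<bar>u1 p\<bar> \<le> M"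
    "\<And>p. p \<in> square \<Longrightarrow> \<bar>u2 p\<bar> \<le> M" by (rule bounded_on_square) blast
  have "0 \<in> {0..h}" using h by simp
  note borel_fold_u = borel_measurable_continuous_onI[OF cont_fold_u]
  have bd: "\<bar>fold_u_x (fst p) (snd p)\<bar> \<le> M" "\<bar>(fold_u_x (fst p) (snd p))\<^sup>2\<bar> \<le> M\<^sup>2" if "p \<in> square" for p
    using fold_u_x_bounded[OF M(2,3), of "fst p" "snd p"] that
    by (auto simp: mem_Times_iff abs_le_square_iff[symmetric])
  have bdu: "\<bar>(fold_u (fst p) (snd p))\<^sup>2\<bar> \<le> M\<^sup>2" if "p \<in> square" for p
  proof -
    have "(max (fst p) (snd p), min (fst p) (snd p)) \<in> square"
      using that by (auto simp: mem_Times_iff max_def min_def)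
    from M(1)[OF this] show ?thesis by (simp add: fold_u_def abs_le_square_iff[symmetric])
  qed
  have borel_D2: "(\<lambda>p. (fold_u_x (fst p) (snd p))\<^sup>2) \<in> borel_measurable borel"
    using borel_fold_u_x by measurable
  have borel_W2: "(\<lambda>p. (fold_u (fst p) (snd p))\<^sup>2) \<in> borel_measurable borel"
    using borel_fold_u by measurable
  note fubini_W2 = iterated_integral_square[OF borel_W2 bdu, simplified]
  note fubini_D2 = iterated_integral_square[OF borel_D2 bd(2), simplified]
  have int_mean': "set_integrable lborel {0..h} row_mean'"
    unfolding row_mean'_def
    using iterated_integral_square(3)[OF borel_fold_u_x bd(1), simplified] by simp
  have int_mean'2: "set_integrable lborel {0..h} (\<lambda>y. (row_mean' y)\<^sup>2)"
  proof (rule set_integrable_bound)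
    show "set_integrable lborel {0..h} (\<lambda>y. (1 / h) * (LINT x:{0..h}|lborel. (fold_u_x y x)\<^sup>2))"
      using fubini_D2(3) by simp
    have "set_borel_measurable lborel {0..h} (\<lambda>y. row_mean' y)"
      using int_mean' by (simp add: set_integrable_def set_borel_measurable_def)
    then have "(\<lambda>y. (indicator {0..h} y *\<^sub>R row_mean' y)\<^sup>2) \<in> borel_measurable lborel"
      unfolding set_borel_measurable_def by measurable
    then show "set_borel_measurable lborel {0..h} (\<lambda>y. (row_mean' y)\<^sup>2)"
      unfolding set_borel_measurable_def
      by (rule back_subst[where P = "\<lambda>f. f \<in> _"]) (auto split: split_indicator)
    show "AE y in lborel. y \<in> {0..h} \<longrightarrow>
        norm ((row_mean' y)\<^sup>2) \<le> norm ((1 / h) * (LINT x:{0..h}|lborel. (fold_u_x y x)\<^sup>2))"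
    proof (intro AE_I2 impI)
      fix y assume y: "y \<in> {0..h}"
      have "0 \<le> h * (row_mean' y)\<^sup>2" using h by simp
      then show "norm ((row_mean' y)\<^sup>2) \<le> norm ((1 / h) * (LINT x:{0..h}|lborel. (fold_u_x y x)\<^sup>2))"
        using row_mean'_sq_le[OF y] h by (simp add: field_simps)
    qed
  qed
  have mean_0: "row_mean 0 + row_mean h = 0"
  proof -
    have "integral {0..h} (\<lambda>x. fold_u x 0) = integral {0..h} (\<lambda>t. u (t, 0))"
      "integral {0..h} (\<lambda>x. fold_u x h) = integral {0..h} (\<lambda>t. u (h, t))"
      by (auto intro!: Henstock_Kurzweil_Integration.integral_cong simp: fold_u_def max_def min_def)
    then show ?thesis
      using mean h slice_integrals(1)[of 0] slice_integrals(1)[of h]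
      by (simp add: row_mean_def add.commute flip: distrib_left add_divide_distrib)
  qed
  have cont_mean2: "continuous_on {0..h} (\<lambda>y. (row_mean y)\<^sup>2)"
    by (intro continuous_intros cont_row_mean)
  then have int_mean2: "set_integrable lborel {0..h} (\<lambda>y. (row_mean y)\<^sup>2)"
    by (rule borel_integrable_atLeastAtMost')
  have "(LINT y:{0..h}|lborel. (row_mean y)\<^sup>2) \<le> (h / pi)\<^sup>2 * (LINT y:{0..h}|lborel. (row_mean' y)\<^sup>2)"
  proof -
    have bound: "\<bar>row_mean' y\<bar> \<le> M" if "0 < y" "y < h" for y
    proof -
      have "h * (row_mean' y)\<^sup>2 \<le> (LINT x:{0..h}|lborel. (fold_u_x y x)\<^sup>2)"
        using that by (intro row_mean'_sq_le) auto
      also have "\<dots> \<le> (LINT x:{0..h}|lborel. M\<^sup>2)"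
        using that bd(2)[of "(y, _)"]
        by (intro set_integral_mono slice_integrable) (auto intro!: borel_integrable_atLeastAtMost' simp del: set_integral_const)
      also have "\<dots> = h * M\<^sup>2" using h by (simp add: set_lebesgue_integral_def)
      finally have "(row_mean' y)\<^sup>2 \<le> M\<^sup>2" using h by simp
      moreover have "0 \<le> M" using M(1)[of "(0, 0)"] h by auto
      ultimately show ?thesis by (simp add: abs_le_square_iff[symmetric])
    qed
    have "integral {0..h} (\<lambda>y. (row_mean y)\<^sup>2) \<le> (h / pi)\<^sup>2 * integral {0..h} (\<lambda>y. (row_mean' y)\<^sup>2)"
      using int_mean'2
      by (intro antiperiodic_wirtinger[where K = M] h cont_row_mean DERIV_row_mean bound mean_0)
        (auto dest: set_borel_integral_eq_integral(1))
    then show ?thesis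
      using int_mean'2 int_mean2 by (simp add: set_borel_integral_eq_integral)
  qed
  then have column: "h * (LINT y:{0..h}|lborel. (row_mean y)\<^sup>2)
      \<le> (h / pi)\<^sup>2 * (LINT y:{0..h}|lborel. h * (row_mean' y)\<^sup>2)"
    using h by (simp add: mult.left_commute)
  have W2: "(LINT p:square|lborel. (fold_u (fst p) (snd p))\<^sup>2) = 2 * (LINT p:right_triangle h|lborel. (u p)\<^sup>2)"
  proof -
    have eq: "(\<lambda>p. (fold_u (fst p) (snd p))\<^sup>2) = (\<lambda>p. if fst p < snd p then (u (snd p, fst p))\<^sup>2 else (u p)\<^sup>2)"
      by (auto simp: fold_u_def fun_eq_iff max_def min_def)
    have b: "(\<lambda>p. (u p)\<^sup>2) \<in> borel_measurable borel"
      by (intro borel_measurable_continuous_onI continuous_intros cont_u)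
    have sq: "\<bar>(u p)\<^sup>2\<bar> \<le> M\<^sup>2" if "p \<in> square" for p
      using M(1)[OF that] by (simp add: abs_le_square_iff[symmetric])
    show ?thesis
      unfolding eq using integral_square_fold[OF b sq b sq] by simp
  qed
  have D2: "(LINT p:square|lborel. (fold_u_x (fst p) (snd p))\<^sup>2)
      = (LINT p:right_triangle h|lborel. (u1 p)\<^sup>2 + (u2 p)\<^sup>2)"
  proof -
    have eq: "(\<lambda>p. (fold_u_x (fst p) (snd p))\<^sup>2) = (\<lambda>p. if fst p < snd p then (u2 (snd p, fst p))\<^sup>2 else (u1 p)\<^sup>2)"
      by (auto simp: fold_u_x_def fun_eq_iff)
    have b: "(\<lambda>p. (u1 p)\<^sup>2) \<in> borel_measurable borel" "(\<lambda>p. (u2 p)\<^sup>2) \<in> borel_measurable borel"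
      by (intro borel_measurable_continuous_onI continuous_intros cont_u1 cont_u2)+
    have sq: "\<bar>(u1 p)\<^sup>2\<bar> \<le> M\<^sup>2" "\<bar>(u2 p)\<^sup>2\<bar> \<le> M\<^sup>2" if "p \<in> square" for p
      using M(2,3)[OF that] by (simp_all add: abs_le_square_iff[symmetric])
    have "set_integrable lborel (right_triangle h) (\<lambda>p. (u1 p)\<^sup>2)"
      "set_integrable lborel (right_triangle h) (\<lambda>p. (u2 p)\<^sup>2)"
      using right_triangle_subset_square sq b
      by (intro set_integrable_bounded_borel[where M = "M\<^sup>2"] bounded_right_triangle borel_right_triangle; blast)+
    then have "(LINT p:right_triangle h|lborel. (u1 p)\<^sup>2 + (u2 p)\<^sup>2)
        = (LINT p:right_triangle h|lborel. (u2 p)\<^sup>2) + (LINT p:right_triangle h|lborel. (u1 p)\<^sup>2)"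
      by (simp add: set_integral_add)
    then show ?thesis
      unfolding eq using integral_square_fold[OF b(1) sq(1) b(2) sq(2)] by simp
  qed
  have "(LINT p:square|lborel. (fold_u (fst p) (snd p))\<^sup>2)
      = (LINT y:{0..h}|lborel. LINT x:{0..h}|lborel. (fold_u x y)\<^sup>2)"
    using fubini_W2(2) by simp
  also have "\<dots> \<le> (LINT y:{0..h}|lborel. h * (row_mean y)\<^sup>2
      + (h / pi)\<^sup>2 * (LINT x:{0..h}|lborel. (fold_u_x x y)\<^sup>2))"
    using fubini_W2(4) fubini_D2(4) int_mean2
    by (intro set_integral_mono set_integral_add(1) set_integrable_mult_right row_wirtinger)
  also have "\<dots> = h * (LINT y:{0..h}|lborel. (row_mean y)\<^sup>2)
      + (h / pi)\<^sup>2 * (LINT p:square|lborel. (fold_u_x (fst p) (snd p))\<^sup>2)"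
    using fubini_D2(2,4) int_mean2 by (subst set_integral_add(2)) simp_all
  also have "h * (LINT y:{0..h}|lborel. (row_mean y)\<^sup>2)
      \<le> (h / pi)\<^sup>2 * (LINT y:{0..h}|lborel. LINT x:{0..h}|lborel. (fold_u_x y x)\<^sup>2)"
    using int_mean'2 fubini_D2(3)
    by (intro order_trans[OF column] mult_left_mono set_integral_mono row_mean'_sq_le) auto
  also have "(LINT y:{0..h}|lborel. LINT x:{0..h}|lborel. (fold_u_x y x)\<^sup>2)
      = (LINT p:square|lborel. (fold_u_x (fst p) (snd p))\<^sup>2)"
    using fubini_D2(1) by simp
  finally show ?thesis
    unfolding W2 D2 by simp
qed

end

section \<open>Square integrable functions\<close>

lemma L2_measurable: "f \<in> L2 M \<Longrightarrow> f \<in> borel_measurable M"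
  and L2_integrable: "f \<in> L2 M \<Longrightarrow> integrable M (\<lambda>x. (norm (f x))\<^sup>2)"
  by (simp_all add: L2_def)

lemma L2_norm_sq: "(L2_norm M f)\<^sup>2 = (LINT x|M. (norm (f x))\<^sup>2)"
  by (simp add: L2_norm_def Bochner_Integration.integral_nonneg)

lemma L2_norm_nonneg: "0 \<le> L2_norm M f"
  by (simp add: L2_norm_def Bochner_Integration.integral_nonneg)

lemma L2_norm_minus_commute: "L2_norm M (\<lambda>x. f x - g x) = L2_norm M (\<lambda>x. g x - f x)"
  by (simp add: L2_norm_def norm_minus_commute)

lemma L2_add:
  fixes f g :: "'a \<Rightarrow> 'b::euclidean_space"
  assumes f: "f \<in> L2 M" and g: "g \<in> L2 M"
  shows "(\<lambda>x. f x + g x) \<in> L2 M"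
proof -
  note [measurable] = L2_measurable[OF f] L2_measurable[OF g]
  have "integrable M (\<lambda>x. (norm (f x + g x))\<^sup>2)"
  proof (rule Bochner_Integration.integrable_bound)
    show "integrable M (\<lambda>x. 2 * (norm (f x))\<^sup>2 + 2 * (norm (g x))\<^sup>2)"
      using L2_integrable[OF f] L2_integrable[OF g] by auto
    have "(norm (f x + g x))\<^sup>2 \<le> 2 * (norm (f x))\<^sup>2 + 2 * (norm (g x))\<^sup>2" for x
    proof -
      have "(norm (f x + g x))\<^sup>2 \<le> (norm (f x) + norm (g x))\<^sup>2"
        by (intro power_mono norm_triangle_ineq) auto
      also have "\<dots> \<le> 2 * (norm (f x))\<^sup>2 + 2 * (norm (g x))\<^sup>2"
        using sum_squares_bound[of "norm (f x)" "norm (g x)"] by (simp add: power2_sum)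
      finally show ?thesis .
    qed
    then show "AE x in M. norm ((norm (f x + g x))\<^sup>2) \<le> norm (2 * (norm (f x))\<^sup>2 + 2 * (norm (g x))\<^sup>2)"
      by simp
  qed measurable
  then show ?thesis by (simp add: L2_def)
qed

lemma L2_uminus: "f \<in> L2 M \<Longrightarrow> (\<lambda>x. - f x) \<in> L2 M"
  by (simp add: L2_def)

lemma L2_diff: "f \<in> L2 M \<Longrightarrow> g \<in> L2 M \<Longrightarrow> (\<lambda>x. f x - g x) \<in> L2 M"
  using L2_add[of f M "\<lambda>x. - g x"] L2_uminus[of g M] by simp

text \<open>
  For \<open>a, b > 0\<close>, \<open>(s + t)\<^sup>2 \<le> (a + b) (s\<^sup>2 / a + t\<^sup>2 / b)\<close>.  Taking for \<open>a\<close> and \<open>b\<close> numbers slightly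
  larger than the two norms keeps the denominators positive when a norm vanishes.
\<close>

lemma L2_norm_triangle:
  fixes f g :: "'a \<Rightarrow> 'b::euclidean_space"
  assumes f: "f \<in> L2 M" and g: "g \<in> L2 M"
  shows "L2_norm M (\<lambda>x. f x + g x) \<le> L2_norm M f + L2_norm M g"
proof (rule field_le_epsilon)
  fix e :: real assume e: "0 < e"
  define a where "a = L2_norm M f + e / 2"
  define b where "b = L2_norm M g + e / 2"
  have ab: "0 < a" "0 < b" "L2_norm M f \<le> a" "L2_norm M g \<le> b"
    using e L2_norm_nonneg[of M f] L2_norm_nonneg[of M g] by (simp_all add: a_def b_def)
  have pointwise: "(norm (f x + g x))\<^sup>2 \<le> (a + b) * ((norm (f x))\<^sup>2 / a + (norm (g x))\<^sup>2 / b)" for x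
  proof -
    have "(norm (f x + g x))\<^sup>2 \<le> (norm (f x) + norm (g x))\<^sup>2"
      by (intro power_mono norm_triangle_ineq) auto
    also have "\<dots> \<le> (a + b) * ((norm (f x))\<^sup>2 / a + (norm (g x))\<^sup>2 / b)"
    proof -
      define s where "s = norm (f x)"
      define t where "t = norm (g x)"
      have "(a + b) * (s\<^sup>2 / a + t\<^sup>2 / b) - (s + t)\<^sup>2 = (b * s - a * t)\<^sup>2 / (a * b)"
        using ab by (simp add: field_simps power2_eq_square)
      moreover have "0 \<le> (b * s - a * t)\<^sup>2 / (a * b)" using ab by simp
      ultimately show ?thesis unfolding s_def t_def by linarith
    qed
    finally show ?thesis .
  qed
  have "(L2_norm M (\<lambda>x. f x + g x))\<^sup>2 \<le> (LINT x|M. (a + b) * ((norm (f x))\<^sup>2 / a + (norm (g x))\<^sup>2 / b))"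
    unfolding L2_norm_sq using pointwise L2_integrable[OF L2_add[OF f g]] L2_integrable[OF f] L2_integrable[OF g]
    by (intro integral_mono) auto
  also have "\<dots> = (a + b) * ((L2_norm M f)\<^sup>2 / a + (L2_norm M g)\<^sup>2 / b)"
    unfolding L2_norm_sq using L2_integrable[OF f] L2_integrable[OF g] by simp
  also have "\<dots> \<le> (a + b) * (a\<^sup>2 / a + b\<^sup>2 / b)"
    using ab L2_norm_nonneg[of M f] L2_norm_nonneg[of M g]
    by (intro mult_left_mono add_mono divide_right_mono power_mono) auto
  also have "\<dots> = (a + b)\<^sup>2" using ab by (simp add: power2_eq_square)
  finally have "L2_norm M (\<lambda>x. f x + g x) \<le> a + b"
    by (rule power2_le_imp_le) (use ab in linarith)
  then show "L2_norm M (\<lambda>x. f x + g x) \<le> L2_norm M f + L2_norm M g + e"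
    by (simp add: a_def b_def)
qed

lemma (in finite_measure) L2_integral_le:
  fixes f :: "'a \<Rightarrow> real"
  assumes f: "f \<in> L2 M"
  shows "integrable M f" and "\<bar>LINT x|M. f x\<bar> \<le> sqrt (measure M (space M)) * L2_norm M f"
proof -
  have f2: "integrable M (\<lambda>x. (f x)\<^sup>2)" using L2_integrable[OF f] by simp
  show int: "integrable M f"
  proof (rule Bochner_Integration.integrable_bound)
    show "integrable M (\<lambda>x. 1 + (f x)\<^sup>2)" using f2 by simp
    have "\<bar>f x\<bar> \<le> 1 + (f x)\<^sup>2" for x
      using sum_squares_bound[of 1 "\<bar>f x\<bar>"] by simp
    then show "AE x in M. norm (f x) \<le> norm (1 + (f x)\<^sup>2)" by simp
  qed (rule L2_measurable[OF f])
  define m where "m = measure M (space M)"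
  define I where "I = (LINT x|M. f x)"
  \<comment> \<open>This is the integral of \<open>(f x - I / m)\<^sup>2\<close>, multiplied by \<open>m\<^sup>2\<close> to avoid a division by \<open>m = 0\<close>.\<close>
  have "0 \<le> (LINT x|M. (m * f x - I)\<^sup>2)" by (intro integral_nonneg_AE) simp
  also have "(LINT x|M. (m * f x - I)\<^sup>2) = (LINT x|M. m\<^sup>2 * (f x)\<^sup>2 - 2 * m * I * f x + I\<^sup>2)"
    by (intro Bochner_Integration.integral_cong) (simp_all add: power2_eq_square algebra_simps)
  also have "\<dots> = m\<^sup>2 * (LINT x|M. (f x)\<^sup>2) - 2 * m * I * I + m * I\<^sup>2"
    using int f2 by (simp add: I_def m_def)
  finally have le: "0 \<le> m * (m * (LINT x|M. (f x)\<^sup>2) - I\<^sup>2)"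
    by (simp add: power2_eq_square algebra_simps)
  have "I\<^sup>2 \<le> m * (LINT x|M. (f x)\<^sup>2)"
  proof (cases "m = 0")
    case True
    then have "emeasure M (space M) = 0" by (simp add: m_def emeasure_eq_measure)
    then have "AE x in M. False" by (intro AE_I[of _ _ "space M"]) auto
    then have "I = 0" unfolding I_def by (intro integral_eq_zero_AE) auto
    with True show ?thesis by simp
  next
    case False
    then have "0 < m" by (simp add: m_def zero_less_measure_iff)
    with le show ?thesis by (simp add: zero_le_mult_iff)
  qed
  then have "sqrt (I\<^sup>2) \<le> sqrt (m * (LINT x|M. (f x)\<^sup>2))" by (rule real_sqrt_le_mono)
  then show "\<bar>LINT x|M. f x\<bar> \<le> sqrt (measure M (space M)) * L2_norm M f"
    by (simp add: I_def m_def L2_norm_def real_sqrt_mult)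
qed

lemma (in finite_measure) L2_bounded:
  fixes f :: "'a \<Rightarrow> 'b::euclidean_space"
  assumes "f \<in> borel_measurable M" "\<And>x. x \<in> space M \<Longrightarrow> norm (f x) \<le> B"
  shows "f \<in> L2 M"
proof -
  have "integrable M (\<lambda>x. (norm (f x))\<^sup>2)"
    using assms by (intro integrable_const_bound[where B = "B\<^sup>2"]) (auto intro!: power_mono)
  with assms show ?thesis by (simp add: L2_def)
qed

section \<open>The boundary of the triangle\<close>

definition legs :: "real \<Rightarrow> (real \<times> real) set" where
  "legs h = {(x1, x2). x1 = h \<and> x2 \<in> {0..h}} \<union> {(x1, x2). x2 = 0 \<and> x1 \<in> {0..h}}"

text \<open>
  The common corner \<open>(h, 0)\<close> belongs to the first segment only, which makes the union disjoint.
\<close>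

lemma legs_eq:
  "legs h = (\<lambda>t. (h, 0) + t *\<^sub>R (0, 1)) ` {0..h} \<union> (\<lambda>t. (0, 0) + t *\<^sub>R (1, 0)) ` {0..<h}"
  if "0 \<le> h"
  using that by (auto simp: legs_def image_iff)

lemma compact_legs: "compact (legs h)"
proof -
  have "legs h = {h} \<times> {0..h} \<union> {0..h} \<times> {0}" by (auto simp: legs_def)
  then show ?thesis by (simp add: compact_Times compact_Un)
qed

lemma closure_right_triangle:
  assumes "0 < h"
  shows "closure (right_triangle h) = {(x, y). 0 \<le> y \<and> y \<le> x \<and> x \<le> h}"
proof
  have "{(x, y). 0 \<le> y \<and> y \<le> x \<and> x \<le> h} = {p. 0 \<le> snd p} \<inter> {p. snd p \<le> fst p} \<inter> {p. fst p \<le> h}"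
    by auto
  also have "closed \<dots>"
    by (intro closed_Int closed_Collect_le continuous_intros)
  finally show "closure (right_triangle h) \<subseteq> {(x, y). 0 \<le> y \<and> y \<le> x \<and> x \<le> h}"
    by (intro closure_minimal) (auto simp: right_triangle_def)
  show "{(x, y). 0 \<le> y \<and> y \<le> x \<and> x \<le> h} \<subseteq> closure (right_triangle h)"
  proof clarify
    fix x y assume xy: "0 \<le> y" "y \<le> x" "x \<le> h"
    define c where "c = (2 * h / 3, h / 3)"
    show "(x, y) \<in> closure (right_triangle h)"
    proof (cases "c = (x, y)")
      case True
      then have "(x, y) \<in> right_triangle h" using assms by (auto simp: c_def right_triangle_def)
      then show ?thesis using closure_subset by blast
    next
      case False
      \<comment> \<open>Moving from the interior point \<open>c\<close> towards a point of the closed triangle stays in the interior.\<close>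
      have "open_segment c (x, y) \<subseteq> right_triangle h"
      proof
        fix q assume "q \<in> open_segment c (x, y)"
        then obtain t where t: "0 < t" "t < 1" "q = (1 - t) *\<^sub>R c + t *\<^sub>R (x, y)"
          by (auto simp: in_segment)
        define s where "s = (1 - t) * (h / 3)"
        have "0 < s" using t assms by (simp add: s_def)
        moreover have "0 \<le> t * y" "t * y \<le> t * x" "t * x \<le> t * h"
          using t xy by (auto intro: mult_left_mono)
        moreover have "fst q = 2 * s + t * x" "snd q = s + t * y" "h = 3 * s + t * h"
          using t(3) by (simp_all add: c_def s_def field_simps)
        ultimately have "0 < snd q" "snd q < fst q" "fst q < h" by linarith+
        then show "q \<in> right_triangle h" by (simp add: right_triangle_def split_beta)
      qed
      then have "closure (open_segment c (x, y)) \<subseteq> closure (right_triangle h)" by (rule closure_mono)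
      then show ?thesis using False by (auto simp: closure_open_segment)
    qed
  qed
qed

lemma frontier_right_triangle:
  assumes "0 < h"
  shows "frontier (right_triangle h) = legs h \<union> (\<lambda>t. (t, t)) ` {0..h}"
  unfolding frontier_def closure_right_triangle[OF assms] interior_open[OF open_right_triangle]
  using assms by (auto simp: right_triangle_def legs_def)

abbreviation arc_length :: "(real \<times> real) measure" where
  "arc_length \<equiv> hausdorff_measure (Suc 0)"

lemma compact_sets_arc_length: "compact S \<Longrightarrow> S \<in> sets arc_length"
  by (intro subsetD[OF borel_subset_hausdorff] borel_closed compact_imp_closed)

lemma emeasure_legs:
  assumes "0 < h" shows "emeasure arc_length (legs h) = ennreal (2 * h)"
proof -
  let ?V = "(\<lambda>t. (h, 0) + t *\<^sub>R (0, 1)) ` {0..h} :: (real \<times> real) set"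
    and ?H = "(\<lambda>t. (0, 0) + t *\<^sub>R (1, 0)) ` {0..<h} :: (real \<times> real) set"
  have "?V \<in> sets borel" by (rule borel_line_image) simp_all
  moreover have "?H \<in> sets borel" by (rule borel_line_image) simp_all
  ultimately have "emeasure arc_length (legs h) = emeasure arc_length ?V + emeasure arc_length ?H"
    unfolding legs_eq[OF less_imp_le[OF assms]]
    by (intro plus_emeasure[symmetric] subsetD[OF borel_subset_hausdorff]) auto
  also have "\<dots> = ennreal h + ennreal h"
    using assms by (simp add: emeasure_hausdorff_line del: scaleR_Pair add_Pair)
  finally show ?thesis using assms by (simp flip: ennreal_plus)
qed

text \<open>
  The diagonal part of the boundary is a segment of a line with unit direction
  \<open>(1 / \<surd>2, 1 / \<surd>2)\<close>, of length \<open>\<surd>2 h\<close>.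
\<close>

lemma finite_measure_frontier:
  assumes "0 < h"
  shows "finite_measure (restrict_space arc_length (frontier (right_triangle h)))"
proof (rule finite_measureI)
  let ?i = "(1 / sqrt 2, 1 / sqrt 2) :: real \<times> real"
  have i: "norm ?i = 1" by (simp add: norm_prod_def power_divide)
  have "(\<lambda>t. (t, t)) ` {0..h} = (\<lambda>t. (0, 0) + t *\<^sub>R ?i) ` {0..sqrt 2 * h}"
  proof (intro set_eqI iffI)
    fix p :: "real \<times> real" assume "p \<in> (\<lambda>t. (t, t)) ` {0..h}"
    then obtain t where t: "p = (t, t)" "0 \<le> t" "t \<le> h" by auto
    then show "p \<in> (\<lambda>t. (0, 0) + t *\<^sub>R ?i) ` {0..sqrt 2 * h}"
      by (intro image_eqI[of _ _ "sqrt 2 * t"]) auto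
  next
    fix p :: "real \<times> real" assume "p \<in> (\<lambda>t. (0, 0) + t *\<^sub>R ?i) ` {0..sqrt 2 * h}"
    then obtain t where "p = (0, 0) + t *\<^sub>R ?i" "0 \<le> t" "t \<le> sqrt 2 * h" by auto
    then show "p \<in> (\<lambda>t. (t, t)) ` {0..h}"
      by (intro image_eqI[of _ _ "t / sqrt 2"]) (auto simp: field_simps)
  qed
  then have D: "emeasure arc_length ((\<lambda>t. (t, t)) ` {0..h}) < \<infinity>"
    using assms by (simp add: emeasure_hausdorff_line[OF i] del: scaleR_Pair add_Pair)
  have "continuous_on {0..h} (\<lambda>t. (t, t))" by (intro continuous_intros)
  then have sets: "legs h \<in> sets arc_length" "(\<lambda>t. (t, t)) ` {0..h} \<in> sets arc_length"
    by (simp_all add: compact_sets_arc_length compact_legs compact_continuous_image)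
  have "emeasure (restrict_space arc_length (frontier (right_triangle h)))
      (space (restrict_space arc_length (frontier (right_triangle h))))
    = emeasure arc_length (legs h \<union> (\<lambda>t. (t, t)) ` {0..h})"
    using sets by (simp add: space_restrict_space emeasure_restrict_space frontier_right_triangle[OF assms])
  also have "\<dots> \<le> emeasure arc_length (legs h) + emeasure arc_length ((\<lambda>t. (t, t)) ` {0..h})"
    by (rule emeasure_subadditive[OF sets])
  also have "\<dots> < \<infinity>" using D by (simp add: emeasure_legs[OF assms])
  finally show "emeasure (restrict_space arc_length (frontier (right_triangle h)))
      (space (restrict_space arc_length (frontier (right_triangle h)))) \<noteq> \<infinity>" by simp
qed

lemma set_integral_legs:
  fixes f :: "real \<times> real \<Rightarrow> real"
  assumes h: "0 < h" and f: "continuous_on UNIV f"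
  shows "(LINT x:legs h|arc_length. f x) = integral {0..h} (\<lambda>t. f (h, t)) + integral {0..h} (\<lambda>t. f (t, 0))"
    and "set_integrable arc_length (legs h) f"
proof -
  let ?V = "(\<lambda>t. (h, 0) + t *\<^sub>R (0, 1)) ` {0..h} :: (real \<times> real) set"
    and ?H = "(\<lambda>t. (0, 0) + t *\<^sub>R (1, 0)) ` {0..<h} :: (real \<times> real) set"
  have norm: "norm (0::real, 1::real) = 1" "norm (1::real, 0::real) = 1" by simp_all
  have fb: "f \<in> borel_measurable borel" by (rule borel_measurable_continuous_onI[OF f])
  have slices: "set_integrable lborel {0..h} (\<lambda>t. f (h, t))" "set_integrable lborel {0..h} (\<lambda>t. f (t, 0))"
    by (auto intro!: borel_integrable_atLeastAtMost' continuous_on_compose2[OF f] continuous_intros)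
  have half_open: "set_integrable lborel {0..<h} (\<lambda>t. f (t, 0))"
    by (rule set_integrable_subset[OF slices(2)]) auto
  have "set_integrable lborel {0..h} (\<lambda>t. f ((h, 0) + t *\<^sub>R (0, 1)))"
    "set_integrable lborel {0..<h} (\<lambda>t. f ((0, 0) + t *\<^sub>R (1, 0)))"
    using slices(1) half_open by simp_all
  then have int: "set_integrable arc_length ?V f" "set_integrable arc_length ?H f"
    by (subst set_integral_hausdorff_line(2)[OF _ _ fb]; simp del: scaleR_Pair add_Pair)+
  have sets: "?V \<in> sets arc_length" "?H \<in> sets arc_length"
    using borel_line_image[OF norm(1), of "{0..h}" "(h, 0)"] borel_line_image[OF norm(2), of "{0..<h}" "(0, 0)"]
      borel_subset_hausdorff[of "Suc 0"] by auto
  show "set_integrable arc_length (legs h) f"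
    unfolding legs_eq[OF less_imp_le[OF h]] by (intro set_integrable_Un int sets)
  have "(LINT x:legs h|arc_length. f x) = (LINT x:?V|arc_length. f x) + (LINT x:?H|arc_length. f x)"
    unfolding legs_eq[OF less_imp_le[OF h]] by (intro set_integral_Un int) auto
  also have "(LINT x:?V|arc_length. f x) = (LINT t:{0..h}|lborel. f (h, t))"
    by (subst set_integral_hausdorff_line(1)[OF norm(1) _ fb]) simp_all
  also have "(LINT x:?H|arc_length. f x) = (LINT t:{0..<h}|lborel. f (t, 0))"
    by (subst set_integral_hausdorff_line(1)[OF norm(2) _ fb]) simp_all
  also have "(LINT t:{0..<h}|lborel. f (t, 0)) = (LINT t:{0..h}|lborel. f (t, 0))"
  proof (rule set_integral_cong_set)
    show "AE t in lborel. t \<in> {0..h} \<longleftrightarrow> t \<in> {0..<h}"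
      using AE_lborel_singleton[of h] by eventually_elim auto
    show sb: "set_borel_measurable lborel {0..h} (\<lambda>t. f (t, 0))"
      using slices(2) by (simp add: set_integrable_def set_borel_measurable_def)
    show "set_borel_measurable lborel {0..<h} (\<lambda>t. f (t, 0))"
      by (rule set_borel_measurable_subset[OF sb]) auto
  qed
  finally show "(LINT x:legs h|arc_length. f x)
      = integral {0..h} (\<lambda>t. f (h, t)) + integral {0..h} (\<lambda>t. f (t, 0))"
    using slices by (simp add: set_borel_integral_eq_integral)
qed

section \<open>The inequality on the Sobolev space\<close>

lemma Basis_plane: "(Basis :: (real \<times> real) set) = {(1, 0), (0, 1)}"
  by (auto simp: Basis_prod_def)

lemma grad_plane:
  fixes u :: "real \<times> real \<Rightarrow> real"
  shows "grad u p = (partial_deriv (1, 0) u p, partial_deriv (0, 1) u p)"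
  by (simp add: grad_def Basis_plane)

lemma smooth_has_derivative:
  fixes u :: "real \<times> real \<Rightarrow> real"
  assumes "smooth u"
  shows "(u has_derivative (\<lambda>v. fst v * partial_deriv (1, 0) u p + snd v * partial_deriv (0, 1) u p)) (at p)"
proof -
  have "C_k (Suc 0) u" using assms unfolding smooth_def by blast
  then have "u differentiable (at p)" by (simp only: C_k.simps)
  then have "(u has_derivative frechet_derivative u (at p)) (at p)"
    by (rule frechet_derivative_works[THEN iffD1])
  moreover have "frechet_derivative u (at p) = (\<lambda>v. fst v * partial_deriv (1, 0) u p + snd v * partial_deriv (0, 1) u p)"
  proof (rule ext)
    fix v
    interpret D: bounded_linear "frechet_derivative u (at p)"
      using calculation by (rule has_derivative_bounded_linear)
    have "frechet_derivative u (at p) v = frechet_derivative u (at p) (fst v *\<^sub>R (1, 0) + snd v *\<^sub>R (0, 1))"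
      by simp
    also have "\<dots> = fst v * partial_deriv (1, 0) u p + snd v * partial_deriv (0, 1) u p"
      unfolding D.add D.scaleR partial_deriv_def by simp
    finally show "frechet_derivative u (at p) v = fst v * partial_deriv (1, 0) u p + snd v * partial_deriv (0, 1) u p" .
  qed
  ultimately show ?thesis by simp
qed

lemma smooth_continuous_partial_deriv:
  assumes "smooth u" "i \<in> Basis" shows "continuous_on UNIV (partial_deriv i u)"
proof -
  have "C_k (Suc 0) u" using assms unfolding smooth_def by blast
  then show ?thesis using assms by simp
qed

lemma smooth_continuous: "smooth u \<Longrightarrow> continuous_on UNIV u"
  unfolding smooth_def by (metis C_k.simps(1))

lemma integral_lebesgue_on_borel:
  fixes F :: "'a::euclidean_space \<Rightarrow> real"
  assumes "F \<in> borel_measurable borel" "S \<in> sets borel"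
  shows "(LINT x|lebesgue_on S. F x) = (LINT x:S|lborel. F x)"
proof -
  have "(LINT x|lebesgue_on S. F x) = (LINT x|lebesgue. indicator S x *\<^sub>R F x)"
    using assms by (intro integral_restrict_space) auto
  also have "\<dots> = (LINT x|lborel. indicator S x *\<^sub>R F x)"
    using assms by (intro integral_completion) auto
  finally show ?thesis by (simp add: set_lebesgue_integral_def)
qed

lemma finite_measure_lebesgue_on:
  assumes "bounded S" "S \<in> sets borel" shows "finite_measure (lebesgue_on S)"
proof (rule finite_measureI)
  show "emeasure (lebesgue_on S) (space (lebesgue_on S)) \<noteq> \<infinity>"
    using assms emeasure_bounded_finite[OF assms(1)]
    by (simp add: space_restrict_space emeasure_restrict_space less_top)
qed

lemma borel_measurable_lebesgue_on_continuous:
  fixes f :: "'a::euclidean_space \<Rightarrow> 'b::euclidean_space"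
  assumes "continuous_on UNIV f" shows "f \<in> borel_measurable (lebesgue_on S)"
  using borel_measurable_continuous_onI[OF assms]
  by (intro measurable_restrict_space1 measurable_completion) simp

lemma continuous_L2_lebesgue_on:
  fixes f :: "'a::euclidean_space \<Rightarrow> 'b::euclidean_space"
  assumes "continuous_on UNIV f" "bounded S" "S \<in> sets borel"
  shows "f \<in> L2 (lebesgue_on S)"
proof -
  interpret finite_measure "lebesgue_on S" using assms(2,3) by (rule finite_measure_lebesgue_on)
  have "continuous_on (closure S) f" by (rule continuous_on_subset[OF assms(1)]) simp
  then have "bounded (f ` closure S)"
    using assms(2) by (intro compact_imp_bounded compact_continuous_image) auto
  then obtain B where "\<And>x. x \<in> closure S \<Longrightarrow> norm (f x) \<le> B" unfolding bounded_iff by blast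
  then show ?thesis
    using closure_subset[of S]
    by (intro L2_bounded[of f B] borel_measurable_lebesgue_on_continuous assms)
       (auto simp: space_restrict_space)
qed

text \<open>
  The number \<open>m\<close> is the mean value of \<open>u\<close> on the legs, whose total length is \<open>2 h\<close>.
\<close>

lemma smooth_poincare:
  fixes u :: "real \<times> real \<Rightarrow> real"
  assumes h: "0 < h" and u: "smooth u"
    and m: "2 * h * m = (LINT x:legs h|arc_length. u x)"
  shows "L2_norm (lebesgue_on (right_triangle h)) (\<lambda>p. u p - m)
    \<le> h / pi * L2_norm (lebesgue_on (right_triangle h)) (grad u)"
proof -
  let ?L = "lebesgue_on (right_triangle h)"
  note cu = smooth_continuous[OF u]
  have cu1: "continuous_on UNIV (partial_deriv (1, 0) u)" and cu2: "continuous_on UNIV (partial_deriv (0, 1) u)"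
    using smooth_continuous_partial_deriv[OF u] by (auto simp: Basis_plane)
  interpret C1_triangle h "\<lambda>p. u p - m" "partial_deriv (1, 0) u" "partial_deriv (0, 1) u"
    using h smooth_has_derivative[OF u] cu1 cu2
    by unfold_locales (auto intro: has_derivative_diff[OF _ has_derivative_const, simplified])
  have slices: "(\<lambda>t. u (h, t)) integrable_on {0..h}" "(\<lambda>t. u (t, 0)) integrable_on {0..h}"
    by (auto intro!: integrable_continuous_real continuous_on_compose2[OF cu] continuous_intros)
  have shift: "integral {0..h} (\<lambda>t. f t - m) = integral {0..h} f - h * m"
    if "f integrable_on {0..h}" for f :: "real \<Rightarrow> real"
    using has_integral_diff[OF integrable_integral[OF that] has_integral_const_real[of m 0 h]] h
    by (simp add: integral_unique)
  have "integral {0..h} (\<lambda>t. u (h, t)) + integral {0..h} (\<lambda>t. u (t, 0)) = 2 * h * m"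
    unfolding m by (rule set_integral_legs(1)[OF h cu, symmetric])
  then have "integral {0..h} (\<lambda>t. u (h, t) - m) + integral {0..h} (\<lambda>t. u (t, 0) - m) = 0"
    using shift[OF slices(1)] shift[OF slices(2)] by simp
  note ineq = triangle_poincare[OF this]
  have "(L2_norm ?L (\<lambda>p. u p - m))\<^sup>2 = (LINT p:right_triangle h|lborel. (u p - m)\<^sup>2)"
    unfolding L2_norm_sq real_norm_def power2_abs
    by (intro integral_lebesgue_on_borel borel_right_triangle borel_measurable_continuous_onI continuous_intros cu)
  also note ineq
  also have "(LINT p:right_triangle h|lborel. (partial_deriv (1, 0) u p)\<^sup>2 + (partial_deriv (0, 1) u p)\<^sup>2)
      = (L2_norm ?L (grad u))\<^sup>2"
    unfolding L2_norm_sq grad_plane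
    by (subst integral_lebesgue_on_borel[symmetric])
       (auto simp: norm_prod_def intro!: borel_measurable_continuous_onI continuous_intros cu1 cu2)
  also have "(h / pi)\<^sup>2 * (L2_norm ?L (grad u))\<^sup>2 = (h / pi * L2_norm ?L (grad u))\<^sup>2"
    by (simp only: power_mult_distrib)
  finally show ?thesis
    by (rule power2_le_imp_le) (use h L2_norm_nonneg[of ?L "grad u"] in simp)
qed

lemma legs_in_frontier: "0 < h \<Longrightarrow> legs h \<subseteq> frontier (right_triangle h)"
  by (simp add: frontier_right_triangle)

text \<open>
  Convergence in \<open>L\<^sup>2\<close> of the whole boundary implies convergence in \<open>L\<^sup>1\<close> of the legs, because the
  measure is finite.
\<close>

lemma tendsto_integral_legs:
  fixes u :: "nat \<Rightarrow> real \<times> real \<Rightarrow> real"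
  assumes h: "0 < h" and g: "g \<in> L2 (restrict_space arc_length (frontier (right_triangle h)))"
    and conv: "L2_tendsto (restrict_space arc_length (frontier (right_triangle h))) u g"
    and cont: "\<And>n. continuous_on UNIV (u n)"
  shows "(\<lambda>n. LINT x:legs h|arc_length. u n x) \<longlonglongrightarrow> (LINT x:legs h|arc_length. g x)"
proof -
  let ?F = "restrict_space arc_length (frontier (right_triangle h))" and ?N = "restrict_space arc_length (legs h)"
  interpret F: finite_measure ?F by (rule finite_measure_frontier[OF h])
  have legs: "legs h \<in> sets arc_length" by (rule compact_sets_arc_length[OF compact_legs])
  have "frontier (right_triangle h) \<in> sets arc_length"
    by (intro compact_sets_arc_length compact_frontier_bounded bounded_right_triangle)
  then have legs_F: "legs h \<in> sets ?F"
    using legs legs_in_frontier[OF h] by (auto simp: sets_restrict_space image_iff)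
  have N: "?N = restrict_space ?F (legs h)"
    using \<open>frontier (right_triangle h) \<in> sets arc_length\<close> legs legs_in_frontier[OF h]
    by (subst restrict_restrict_space) (auto simp: Int_absorb1)
  interpret N: finite_measure ?N
    unfolding N using finite_measure_restrict_space[OF F.finite_measure_axioms] legs_F by auto
  have restrict: "f \<in> L2 ?N" "L2_norm ?N f \<le> L2_norm ?F f" if f: "f \<in> L2 ?F" for f :: "real \<times> real \<Rightarrow> real"
  proof -
    have F_int: "integrable ?F (\<lambda>x. (norm (f x))\<^sup>2)" by (rule L2_integrable[OF f])
    then have ind: "integrable ?F (\<lambda>x. indicator (legs h) x *\<^sub>R (norm (f x))\<^sup>2)"
      using legs_F by (intro integrable_mult_indicator)
    then have "integrable ?N (\<lambda>x. (norm (f x))\<^sup>2)"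
      unfolding N using legs_F by (subst integrable_restrict_space) auto
    moreover have "f \<in> borel_measurable ?N"
      unfolding N by (intro measurable_restrict_space1 L2_measurable f)
    ultimately show "f \<in> L2 ?N" by (simp add: L2_def)
    have "(LINT x|?N. (norm (f x))\<^sup>2) = (LINT x|?F. indicator (legs h) x *\<^sub>R (norm (f x))\<^sup>2)"
      unfolding N using legs_F by (subst integral_restrict_space) auto
    also have "\<dots> \<le> (LINT x|?F. (norm (f x))\<^sup>2)"
      by (intro integral_mono ind F_int) (simp add: indicator_def)
    finally show "L2_norm ?N f \<le> L2_norm ?F f" by (simp add: L2_norm_def)
  qed
  have set_int: "(LINT x:legs h|arc_length. f x) = (LINT x|?N. f x)" for f :: "real \<times> real \<Rightarrow> real"
    using legs by (subst integral_restrict_space) (auto simp: set_lebesgue_integral_def)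
  have u_int: "integrable ?N (u n)" for n
    using set_integral_legs(2)[OF h cont[of n]] legs
    by (subst integrable_restrict_space) (auto simp: set_integrable_def)
  have g_int: "integrable ?N g" by (intro N.L2_integral_le(1) restrict g)
  have bound: "norm ((LINT x|?N. u n x) - (LINT x|?N. g x))
      \<le> sqrt (measure ?N (space ?N)) * L2_norm ?F (\<lambda>x. u n x - g x)" for n
  proof -
    have d: "(\<lambda>x. u n x - g x) \<in> L2 ?F" using conv by (simp add: L2_tendsto_def)
    have "(LINT x|?N. u n x) - (LINT x|?N. g x) = (LINT x|?N. u n x - g x)"
      using u_int g_int by simp
    also have "norm \<dots> \<le> sqrt (measure ?N (space ?N)) * L2_norm ?N (\<lambda>x. u n x - g x)"
      unfolding real_norm_def by (intro N.L2_integral_le(2) restrict d)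
    also have "\<dots> \<le> sqrt (measure ?N (space ?N)) * L2_norm ?F (\<lambda>x. u n x - g x)"
      by (intro mult_left_mono restrict d) simp
    finally show ?thesis .
  qed
  have "(\<lambda>n. sqrt (measure ?N (space ?N)) * L2_norm ?F (\<lambda>x. u n x - g x)) \<longlonglongrightarrow> sqrt (measure ?N (space ?N)) * 0"
    using conv by (intro tendsto_mult_left) (simp add: L2_tendsto_def)
  then have lim: "(\<lambda>n. sqrt (measure ?N (space ?N)) * L2_norm ?F (\<lambda>x. u n x - g x)) \<longlonglongrightarrow> 0"
    by simp
  have "(\<lambda>n. (LINT x|?N. u n x) - (LINT x|?N. g x)) \<longlonglongrightarrow> 0"
    by (rule Lim_null_comparison[OF always_eventually[OF allI[OF bound]] lim])
  then show ?thesis unfolding set_int by (simp add: LIM_zero_iff)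
qed

text \<open>
  Let \<open>m n\<close> be the mean value of the approximation \<open>u n\<close> on the legs.  It tends to zero, and so
  \<open>u n - m n\<close>, to which \<open>smooth_poincare\<close> applies, still converges to \<open>w\<close>.
\<close>

lemma poincare_bound_right_triangle:
  assumes h: "0 < h"
  shows "poincare_bound (right_triangle h) (legs h) (h / pi)"
  unfolding poincare_bound_def
proof (clarify)
  fix w G assume W: "(w, G) \<in> H1_mean_zero (right_triangle h) (legs h)"
  let ?L = "lebesgue_on (right_triangle h)"
  let ?F = "restrict_space arc_length (frontier (right_triangle h))"
  from W obtain g u where wG: "w \<in> L2 ?L" "G \<in> L2 ?L"
    and g: "g \<in> L2 ?F" "mean_value (legs h) g = 0"
    and u: "\<And>n. smooth (u n)" "L2_tendsto ?L u w" "L2_tendsto ?L (\<lambda>n. grad (u n)) G" "L2_tendsto ?F u g"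
    by (auto simp: H1_mean_zero_def H1_def has_trace_def)
  define m where "m n = (LINT x:legs h|arc_length. u n x) / (2 * h)" for n
  have "measure arc_length (legs h) \<noteq> 0"
    using emeasure_legs[OF h] h by (simp add: measure_def)
  then have g0: "(LINT x:legs h|arc_length. g x) = 0"
    using g(2) by (simp add: mean_value_def)
  have "(\<lambda>n. LINT x:legs h|arc_length. u n x) \<longlonglongrightarrow> 0"
    using tendsto_integral_legs[OF h g(1) u(4) smooth_continuous[OF u(1)]] unfolding g0 .
  then have m_lim: "m \<longlonglongrightarrow> 0"
    unfolding m_def by (rule tendsto_divide_zero)
  have const_L2: "(\<lambda>p. c) \<in> L2 ?L" for c :: real
    by (intro continuous_L2_lebesgue_on continuous_intros bounded_right_triangle borel_right_triangle)
  have u_L2: "u n \<in> L2 ?L" for n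
    by (intro continuous_L2_lebesgue_on smooth_continuous u bounded_right_triangle borel_right_triangle)
  have dw: "(\<lambda>p. u n p - w p) \<in> L2 ?L" and dG: "(\<lambda>p. grad (u n) p - G p) \<in> L2 ?L" for n
    using u(2,3) by (simp_all add: L2_tendsto_def)
  have est: "L2_norm ?L w \<le> L2_norm ?L (\<lambda>p. u n p - w p)
      + (h / pi * (L2_norm ?L (\<lambda>p. grad (u n) p - G p) + L2_norm ?L G) + \<bar>m n\<bar> * L2_norm ?L (\<lambda>p. 1::real))" for n
  proof -
    have "L2_norm ?L w = L2_norm ?L (\<lambda>p. (w p - u n p) + ((u n p - m n) + m n))"
      by simp
    also have "\<dots> \<le> L2_norm ?L (\<lambda>p. w p - u n p) + L2_norm ?L (\<lambda>p. (u n p - m n) + m n)"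
      by (intro L2_norm_triangle L2_add L2_diff wG u_L2 const_L2)
    also have "\<dots> \<le> L2_norm ?L (\<lambda>p. w p - u n p) + (L2_norm ?L (\<lambda>p. u n p - m n) + L2_norm ?L (\<lambda>p. m n))"
      by (intro add_left_mono L2_norm_triangle L2_diff u_L2 const_L2)
    also have "L2_norm ?L (\<lambda>p. w p - u n p) = L2_norm ?L (\<lambda>p. u n p - w p)"
      by (rule L2_norm_minus_commute)
    also have "L2_norm ?L (\<lambda>p. m n) = \<bar>m n\<bar> * L2_norm ?L (\<lambda>p. 1::real)"
      by (simp add: L2_norm_def real_sqrt_mult)
    also have "L2_norm ?L (\<lambda>p. u n p - m n) \<le> h / pi * L2_norm ?L (grad (u n))"
      using h by (intro smooth_poincare u) (simp_all add: m_def)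
    also have "L2_norm ?L (grad (u n)) = L2_norm ?L (\<lambda>p. (grad (u n) p - G p) + G p)"
      by simp
    also have "\<dots> \<le> L2_norm ?L (\<lambda>p. grad (u n) p - G p) + L2_norm ?L G"
      by (intro L2_norm_triangle dG wG)
    finally show ?thesis using h by (simp add: mult_left_mono divide_right_mono)
  qed
  have "(\<lambda>n. L2_norm ?L (\<lambda>p. u n p - w p)
      + (h / pi * (L2_norm ?L (\<lambda>p. grad (u n) p - G p) + L2_norm ?L G) + \<bar>m n\<bar> * L2_norm ?L (\<lambda>p. 1::real)))
    \<longlonglongrightarrow> 0 + (h / pi * (0 + L2_norm ?L G) + \<bar>0\<bar> * L2_norm ?L (\<lambda>p. 1::real))"
    using u(2,3) by (intro tendsto_intros m_lim) (simp_all add: L2_tendsto_def)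
  then have "L2_norm ?L w \<le> 0 + (h / pi * (0 + L2_norm ?L G) + \<bar>0\<bar> * L2_norm ?L (\<lambda>p. 1::real))"
    by (rule LIMSEQ_le_const) (use est in auto)
  then show "L2_norm ?L w \<le> h / pi * L2_norm ?L G" by simp
qed

section \<open>Weak gradients of smooth functions\<close>

lemma partial_deriv_eq: "(f has_derivative D) (at x) \<Longrightarrow> partial_deriv i f x = D i"
  unfolding partial_deriv_def using frechet_derivative_at by metis

text \<open>
  By Fubini's theorem, since the integral of \<open>F1\<close> along a horizontal line and that of \<open>F2\<close> along a
  vertical line are differences of values of \<open>F\<close> outside its support.
\<close>

lemma integral_partial_deriv_compact_support:
  fixes F F1 F2 :: "real \<times> real \<Rightarrow> real"
  assumes F: "\<And>p. (F has_derivative (\<lambda>v. fst v * F1 p + snd v * F2 p)) (at p)"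
    and cont: "continuous_on UNIV F1" "continuous_on UNIV F2"
    and K: "bounded K" and zero: "\<And>p. p \<notin> K \<Longrightarrow> F p = 0 \<and> F1 p = 0 \<and> F2 p = 0"
  shows "(LINT p|lborel. F1 p) = 0" and "(LINT p|lborel. F2 p) = 0"
proof -
  interpret C1_triangle 1 F F1 F2 using F cont by unfold_locales auto
  obtain R where R: "0 < R" "\<And>p. p \<in> K \<Longrightarrow> norm p < R"
    using K by (metis bounded_pos_less)
  have outside: "F p = 0 \<and> F1 p = 0 \<and> F2 p = 0" if "R \<le> \<bar>fst p\<bar> \<or> R \<le> \<bar>snd p\<bar>" for p
  proof (rule zero)
    have "\<bar>fst p\<bar> \<le> norm p" "\<bar>snd p\<bar> \<le> norm p"
      using norm_fst_le[of "fst p" "snd p"] norm_snd_le[of "snd p" "fst p"] by simp_all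
    with that R(2)[of p] show "p \<notin> K" by auto
  qed
  let ?S = "{- R..R} \<times> {- R..R}"
  have c: "compact ?S" by (simp add: compact_Times)
  obtain M1 where M1: "\<And>p. p \<in> ?S \<Longrightarrow> \<bar>F1 p\<bar> \<le> M1"
    using continuous_bounded_on_compact[OF c] cont(1) continuous_on_subset by (metis subset_UNIV)
  obtain M2 where M2: "\<And>p. p \<in> ?S \<Longrightarrow> \<bar>F2 p\<bar> \<le> M2"
    using continuous_bounded_on_compact[OF c] cont(2) continuous_on_subset by (metis subset_UNIV)
  have restrict: "(LINT p|lborel. f p) = (LINT p:?S|lborel. f p)"
    if "\<And>p. R \<le> \<bar>fst p\<bar> \<or> R \<le> \<bar>snd p\<bar> \<Longrightarrow> f p = 0" for f :: "real \<times> real \<Rightarrow> real"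
    unfolding set_lebesgue_integral_def
  proof (rule Bochner_Integration.integral_cong[OF refl])
    fix p show "f p = indicator ?S p *\<^sub>R f p"
      using that[of p] by (cases "p \<in> ?S") (auto simp: mem_Times_iff abs_if split: if_splits)
  qed
  have row: "(LINT x:{- R..R}|lborel. F1 (x, y)) = 0" for y
  proof -
    have "((\<lambda>x. F1 (x, y)) has_integral (F (R, y) - F (- R, y))) {- R..R}"
      using R(1) DERIV_u_fst[of y]
      by (intro fundamental_theorem_of_calculus)
         (auto simp: has_real_derivative_iff_has_vector_derivative intro: has_vector_derivative_at_within)
    moreover have "set_integrable lborel {- R..R} (\<lambda>x. F1 (x, y))"
      by (intro borel_integrable_atLeastAtMost' cont_u1_compose continuous_intros)
    ultimately show ?thesis
      using outside[of "(R, y)"] outside[of "(- R, y)"] R(1)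
      by (simp add: set_borel_integral_eq_integral(2)[symmetric] has_integral_iff)
  qed
  have column: "(LINT y:{- R..R}|lborel. F2 (x, y)) = 0" for x
  proof -
    have "((\<lambda>y. F2 (x, y)) has_integral (F (x, R) - F (x, - R))) {- R..R}"
      using R(1) DERIV_u_snd[of x]
      by (intro fundamental_theorem_of_calculus)
         (auto simp: has_real_derivative_iff_has_vector_derivative intro: has_vector_derivative_at_within)
    moreover have "set_integrable lborel {- R..R} (\<lambda>y. F2 (x, y))"
      by (intro borel_integrable_atLeastAtMost' cont_u2_compose continuous_intros)
    ultimately show ?thesis
      using outside[of "(x, R)"] outside[of "(x, - R)"] R(1)
      by (simp add: set_borel_integral_eq_integral(2)[symmetric] has_integral_iff)
  qed
  have "(LINT p:?S|lborel. F1 p) = 0"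
    using iterated_integral_square(2)[where a = "- R" and b = R, OF borel_measurable_continuous_onI[OF cont(1)] M1] row
    by (simp add: set_lebesgue_integral_def)
  then show "(LINT p|lborel. F1 p) = 0" using restrict[of F1] outside by auto
  have "(LINT p:?S|lborel. F2 p) = 0"
    using iterated_integral_square(1)[where a = "- R" and b = R, OF borel_measurable_continuous_onI[OF cont(2)] M2] column
    by (simp add: set_lebesgue_integral_def)
  then show "(LINT p|lborel. F2 p) = 0" using restrict[of F2] outside by auto
qed

text \<open>
  The product \<open>w \<phi>\<close>, continued by zero, has compact support in the plane, so the integrals of its
  partial derivatives vanish.
\<close>

lemma smooth_weak_gradient:
  fixes w :: "real \<times> real \<Rightarrow> real"
  assumes w: "smooth w" and \<Omega>: "bounded \<Omega>" "\<Omega> \<in> sets borel"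
  shows "weak_gradient \<Omega> w (grad w)"
  unfolding weak_gradient_def
proof (intro allI impI ballI)
  fix \<phi> :: "real \<times> real \<Rightarrow> real" and i :: "real \<times> real"
  assume \<phi>: "test_function \<Omega> \<phi>" and i: "i \<in> Basis"
  define K where "K = closure {x. \<phi> x \<noteq> 0}"
  have smooth\<phi>: "smooth \<phi>" and K: "compact K" "K \<subseteq> \<Omega>"
    using \<phi> by (auto simp: test_function_def K_def)
  have \<phi>0: "\<phi> p = 0" if "p \<notin> K" for p
    using that closure_subset[of "{x. \<phi> x \<noteq> 0}"] by (auto simp: K_def)
  have d\<phi>0: "partial_deriv j \<phi> p = 0" if "p \<notin> K" for p j
  proof -
    have "((\<lambda>p. 0) has_derivative (\<lambda>v. 0)) (at p)" by simp
    then have "(\<phi> has_derivative (\<lambda>v. 0)) (at p)"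
      by (rule has_derivative_transform_within_open[where s = "- K"])
        (use that K \<phi>0 in \<open>auto simp: open_Compl compact_imp_closed\<close>)
    then show ?thesis by (simp add: partial_deriv_eq)
  qed
  define F where "F j p = w p * partial_deriv j \<phi> p + partial_deriv j w p * \<phi> p" for j p
  have deriv: "((\<lambda>p. w p * \<phi> p) has_derivative (\<lambda>v. fst v * F (1, 0) p + snd v * F (0, 1) p)) (at p)" for p
    by (rule has_derivative_eq_rhs[OF has_derivative_mult[OF smooth_has_derivative[OF w] smooth_has_derivative[OF smooth\<phi>]]])
       (simp add: F_def fun_eq_iff algebra_simps)
  have cont: "continuous_on UNIV w" "continuous_on UNIV \<phi>"
    "continuous_on UNIV (partial_deriv j w)" "continuous_on UNIV (partial_deriv j \<phi>)" if "j \<in> Basis" for j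
    using that by (auto intro: smooth_continuous smooth_continuous_partial_deriv w smooth\<phi>)
  have contF: "continuous_on UNIV (F j)" if "j \<in> Basis" for j
    unfolding F_def using cont[OF that] by (intro continuous_intros)
  have vanish: "w p * \<phi> p = 0 \<and> F (1, 0) p = 0 \<and> F (0, 1) p = 0" if "p \<notin> K" for p
    using \<phi>0[OF that] d\<phi>0[OF that] by (simp add: F_def)
  have "continuous_on UNIV (F (1, 0))" "continuous_on UNIV (F (0, 1))"
    by (auto intro!: contF simp: Basis_plane)
  from integral_partial_deriv_compact_support[OF deriv this compact_imp_bounded[OF K(1)] vanish]
  have "(LINT p|lborel. F i p) = 0" using i by (auto simp: Basis_plane)
  moreover have "(LINT p|lborel. F i p) = (LINT p:\<Omega>|lborel. F i p)"
    unfolding set_lebesgue_integral_def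
  proof (rule Bochner_Integration.integral_cong[OF refl])
    fix p show "F i p = indicator \<Omega> p *\<^sub>R F i p"
    proof (cases "p \<in> \<Omega>")
      case False
      then have "p \<notin> K" using K(2) by blast
      then show ?thesis using False \<phi>0 d\<phi>0 by (simp add: F_def)
    qed simp
  qed
  moreover have "(LINT p|lebesgue_on \<Omega>. F i p) = (LINT p:\<Omega>|lborel. F i p)"
    by (intro integral_lebesgue_on_borel borel_measurable_continuous_onI contF i \<Omega>)
  moreover have "(LINT p|lebesgue_on \<Omega>. F i p)
      = (LINT x|lebesgue_on \<Omega>. w x * partial_deriv i \<phi> x) + (LINT x|lebesgue_on \<Omega>. (grad w x \<bullet> i) * \<phi> x)"
  proof -
    interpret finite_measure "lebesgue_on \<Omega>" using \<Omega> by (rule finite_measure_lebesgue_on)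
    have "integrable (lebesgue_on \<Omega>) (\<lambda>x. w x * partial_deriv i \<phi> x)"
      "integrable (lebesgue_on \<Omega>) (\<lambda>x. partial_deriv i w x * \<phi> x)"
      by (intro L2_integral_le(1) continuous_L2_lebesgue_on \<Omega> continuous_intros cont[OF i])+
    moreover have "grad w x \<bullet> i = partial_deriv i w x" for x
      using i by (auto simp: grad_plane Basis_plane)
    ultimately show ?thesis by (simp add: F_def)
  qed
  ultimately show "(LINT x|lebesgue_on \<Omega>. w x * partial_deriv i \<phi> x)
      = - (LINT x|lebesgue_on \<Omega>. (grad w x \<bullet> i) * \<phi> x)"
    by linarith
qed

section \<open>The extremal function\<close>

text \<open>
  A partial derivative of such a function is of the same form, because the cosine is a shifted sine.
\<close>

lemma C_k_trig:
  fixes A a \<alpha> B b \<beta> :: real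
  shows "C_k k (\<lambda>p::real \<times> real. A * sin (a * fst p + \<alpha>) + B * sin (b * snd p + \<beta>))"
proof (induction k arbitrary: A a \<alpha> B b \<beta>)
  case 0
  show ?case unfolding C_k.simps by (intro continuous_intros)
next
  case (Suc k)
  let ?f = "\<lambda>A \<alpha> B \<beta> (p::real \<times> real). A * sin (a * fst p + \<alpha>) + B * sin (b * snd p + \<beta>)"
  have D: "(?f A \<alpha> B \<beta> has_derivative
      (\<lambda>v. A * cos (a * fst p + \<alpha>) * (a * fst v) + B * cos (b * snd p + \<beta>) * (b * snd v))) (at p)" for p
    by (auto intro!: derivative_eq_intros)
  have "sin (x + pi / 2) = cos x" for x :: real by (simp add: sin_add)
  then have shift: "sin (x + (y + pi / 2)) = cos (x + y)" for x y :: real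
    by (simp only: add.assoc[symmetric])
  have "partial_deriv (1, 0) (?f A \<alpha> B \<beta>) = ?f (A * a) (\<alpha> + pi / 2) 0 0"
    and "partial_deriv (0, 1) (?f A \<alpha> B \<beta>) = ?f 0 0 (B * b) (\<beta> + pi / 2)"
    by (simp_all add: fun_eq_iff partial_deriv_eq[OF D] shift)
  moreover have "\<forall>p. ?f A \<alpha> B \<beta> differentiable (at p)"
    using D unfolding differentiable_def by blast
  ultimately show ?case
    using Suc.IH[of "A * a" a "\<alpha> + pi / 2" 0 b 0] Suc.IH[of 0 a 0 "B * b" b "\<beta> + pi / 2"]
    by (simp add: Basis_plane)
qed

text \<open>
  The first nonconstant Neumann eigenfunction of the triangle.
\<close>

definition extremal :: "real \<Rightarrow> real \<times> real \<Rightarrow> real" where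
  "extremal h p = cos (pi / h * fst p) + cos (pi / h * snd p)"

lemma smooth_extremal: "smooth (extremal h)"
proof -
  have eq: "extremal h = (\<lambda>p. 1 * sin (pi / h * fst p + pi / 2) + 1 * sin (pi / h * snd p + pi / 2))"
    by (simp add: fun_eq_iff extremal_def sin_add)
  show ?thesis unfolding smooth_def eq by (intro allI C_k_trig)
qed

lemma grad_extremal:
  "grad (extremal h) p = (- (pi / h) * sin (pi / h * fst p), - (pi / h) * sin (pi / h * snd p))"
proof -
  have "((\<lambda>p. cos (k * fst p) + cos (k * snd p)) has_derivative
      (\<lambda>v. - sin (k * fst p) * (k * fst v) - sin (k * snd p) * (k * snd v))) (at p)" for k
    by (auto intro!: derivative_eq_intros)
  from this[of "pi / h"] have "(extremal h has_derivative
      (\<lambda>v. - sin (pi / h * fst p) * (pi / h * fst v) - sin (pi / h * snd p) * (pi / h * snd v))) (at p)"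
    unfolding extremal_def .
  then show ?thesis by (simp add: grad_plane partial_deriv_eq)
qed

lemma integral_cos_period:
  assumes "0 < h"
  shows "integral {0..h} (\<lambda>t. cos (pi / h * t)) = 0"
    and "integral {0..h} (\<lambda>t. (cos (pi / h * t))\<^sup>2) = h / 2"
    and "integral {0..h} (\<lambda>t. (sin (pi / h * t))\<^sup>2) = h / 2"
proof -
  define k where "k = pi / h"
  have k: "k \<noteq> 0" "k * h = pi" using assms by (simp_all add: k_def)
  have "((\<lambda>t. cos (k * t)) has_integral (sin (k * h) / k - sin (k * 0) / k)) {0..h}"
    using assms k
    by (intro fundamental_theorem_of_calculus)
       (auto intro!: derivative_eq_intros simp flip: has_real_derivative_iff_has_vector_derivative)
  then show "integral {0..h} (\<lambda>t. cos (pi / h * t)) = 0"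
    unfolding k(2) k_def[symmetric] by (simp add: has_integral_iff)
  have "((\<lambda>t. (cos (k * t))\<^sup>2) has_integral
      ((h / 2 + sin (k * h) * cos (k * h) / (2 * k)) - (0 / 2 + sin (k * 0) * cos (k * 0) / (2 * k)))) {0..h}"
    using assms k
    by (intro fundamental_theorem_of_calculus)
       (auto intro!: derivative_eq_intros simp: field_simps power2_eq_square sin_squared_eq[unfolded power2_eq_square]
         simp flip: has_real_derivative_iff_has_vector_derivative)
  then have c2: "((\<lambda>t. (cos (k * t))\<^sup>2) has_integral (h / 2)) {0..h}"
    unfolding k(2) by simp
  then show "integral {0..h} (\<lambda>t. (cos (pi / h * t))\<^sup>2) = h / 2"
    unfolding k_def by (simp add: has_integral_iff)
  have "((\<lambda>t. 1 - (cos (k * t))\<^sup>2) has_integral (h - h / 2)) {0..h}"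
    using has_integral_diff[OF has_integral_const_real[of "1::real" 0 h] c2] assms by simp
  then show "integral {0..h} (\<lambda>t. (sin (pi / h * t))\<^sup>2) = h / 2"
    unfolding k_def sin_squared_eq by (simp add: has_integral_iff)
qed

text \<open>
  The integrand is symmetric, so its integral over the triangle is half of the integral over the
  square, where the variables separate.
\<close>

lemma integral_right_triangle_symmetric:
  fixes a b :: "real \<Rightarrow> real"
  assumes h: "0 < h" and cont: "continuous_on UNIV a" "continuous_on UNIV b"
  shows "2 * (LINT p|lebesgue_on (right_triangle h). a (fst p) + a (snd p) + 2 * (b (fst p) * b (snd p)))
    = 2 * (h * integral {0..h} a + (integral {0..h} b)\<^sup>2)"
proof -
  let ?S = "{0..h} \<times> {0..h}" and ?F = "\<lambda>p. a (fst p) + a (snd p) + 2 * (b (fst p) * b (snd p))"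
  let ?A = "integral {0..h} a" and ?B = "integral {0..h} b"
  have contF: "continuous_on UNIV ?F"
    by (intro continuous_intros continuous_on_compose2[OF cont(1)] continuous_on_compose2[OF cont(2)]) auto
  have F: "?F \<in> borel_measurable borel" by (rule borel_measurable_continuous_onI[OF contF])
  have "compact ?S" by (simp add: compact_Times)
  then obtain M where M: "\<And>p. p \<in> ?S \<Longrightarrow> \<bar>?F p\<bar> \<le> M"
    by (rule continuous_bounded_on_compact[OF _ continuous_on_subset[OF contF subset_UNIV]]) blast
  have ab: "(a has_integral ?A) {0..h}" "(b has_integral ?B) {0..h}"
    by (auto intro!: integrable_integral integrable_continuous_real continuous_on_subset[OF cont(1)]
        continuous_on_subset[OF cont(2)])
  have const: "((\<lambda>t. c) has_integral h * c) {0..h}" for c :: real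
    using has_integral_const_real[of c 0 h] h by simp
  have to_HK: "(LINT t:{0..h}|lborel. f t) = I" if "(f has_integral I) {0..h}" "continuous_on UNIV f"
    for f :: "real \<Rightarrow> real" and I
  proof -
    have "set_integrable lborel {0..h} f"
      by (intro borel_integrable_atLeastAtMost' continuous_on_subset[OF that(2)]) simp
    from set_borel_integral_eq_integral(2)[OF this] that(1) show ?thesis by (simp add: integral_unique)
  qed
  have inner: "(LINT y:{0..h}|lborel. ?F (x, y)) = h * a x + ?A + 2 * b x * ?B" for x
  proof (rule to_HK)
    have "((\<lambda>y. a x + a y + (2 * b x) * b y) has_integral (h * a x + ?A + (2 * b x) * ?B)) {0..h}"
      by (intro has_integral_add const ab has_integral_mult_right)
    then show "((\<lambda>y. ?F (x, y)) has_integral (h * a x + ?A + 2 * b x * ?B)) {0..h}"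
      by (simp add: mult.assoc)
    show "continuous_on UNIV (\<lambda>y. ?F (x, y))"
      using cont by (intro continuous_intros) auto
  qed
  have outer: "(LINT x:{0..h}|lborel. h * a x + ?A + 2 * b x * ?B) = h * ?A + h * ?A + 2 * ?B * ?B"
  proof (rule to_HK)
    have "((\<lambda>x. h * a x + ?A + (2 * ?B) * b x) has_integral (h * ?A + h * ?A + 2 * ?B * ?B)) {0..h}"
      by (intro has_integral_add const ab has_integral_mult_right)
    then show "((\<lambda>x. h * a x + ?A + 2 * b x * ?B) has_integral (h * ?A + h * ?A + 2 * ?B * ?B)) {0..h}"
      by (simp add: ac_simps)
    show "continuous_on UNIV (\<lambda>x. h * a x + ?A + 2 * b x * ?B)"
      using cont by (intro continuous_intros)
  qed
  have "(LINT p:?S|lborel. ?F p) = h * ?A + h * ?A + 2 * ?B * ?B"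
    using iterated_integral_square(1)[where a = 0 and b = h, OF F M] unfolding inner outer by simp
  moreover have "(\<lambda>p. if fst p < snd p then ?F (snd p, fst p) else ?F p) = ?F"
    by (auto simp: fun_eq_iff)
  then have "(LINT p:?S|lborel. ?F p) = (LINT p:right_triangle h|lborel. ?F p) + (LINT p:right_triangle h|lborel. ?F p)"
    using integral_square_fold[OF F M F M] by simp
  moreover have "(LINT p|lebesgue_on (right_triangle h). ?F p) = (LINT p:right_triangle h|lborel. ?F p)"
    by (rule integral_lebesgue_on_borel[OF F borel_right_triangle])
  ultimately show ?thesis by (simp add: power2_eq_square)
qed

lemma L2_norm_extremal:
  assumes h: "0 < h"
  shows "(L2_norm (lebesgue_on (right_triangle h)) (extremal h))\<^sup>2 = h\<^sup>2 / 2"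
    and "(L2_norm (lebesgue_on (right_triangle h)) (grad (extremal h)))\<^sup>2 = pi\<^sup>2 / 2"
proof -
  have cont: "continuous_on UNIV (\<lambda>t. (cos (pi / h * t))\<^sup>2)" "continuous_on UNIV (\<lambda>t. cos (pi / h * t))"
    "continuous_on UNIV (\<lambda>t. (pi / h)\<^sup>2 * (sin (pi / h * t))\<^sup>2)" "continuous_on UNIV (\<lambda>t::real. 0::real)"
    by (intro continuous_intros)+
  let ?L = "lebesgue_on (right_triangle h)"
  have "(norm (extremal h p))\<^sup>2 = (cos (pi / h * fst p))\<^sup>2 + (cos (pi / h * snd p))\<^sup>2
      + 2 * (cos (pi / h * fst p) * cos (pi / h * snd p))" for p
    by (simp add: extremal_def power2_sum)
  then have "2 * (L2_norm ?L (extremal h))\<^sup>2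
      = 2 * (h * integral {0..h} (\<lambda>t. (cos (pi / h * t))\<^sup>2) + (integral {0..h} (\<lambda>t. cos (pi / h * t)))\<^sup>2)"
    unfolding L2_norm_sq by (simp only: integral_right_triangle_symmetric[OF h cont(1,2)])
  then show "(L2_norm ?L (extremal h))\<^sup>2 = h\<^sup>2 / 2"
    unfolding integral_cos_period[OF h] by (simp add: power2_eq_square)
  have "(norm (grad (extremal h) p))\<^sup>2 = (pi / h)\<^sup>2 * (sin (pi / h * fst p))\<^sup>2
      + (pi / h)\<^sup>2 * (sin (pi / h * snd p))\<^sup>2 + 2 * (0 * 0)" for p
    unfolding grad_extremal by (simp add: norm_prod_def power_mult_distrib power_divide)
  then have "2 * (L2_norm ?L (grad (extremal h)))\<^sup>2
      = 2 * (h * integral {0..h} (\<lambda>t. (pi / h)\<^sup>2 * (sin (pi / h * t))\<^sup>2) + (integral {0..h} (\<lambda>t. 0))\<^sup>2)"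
    unfolding L2_norm_sq by (simp only: integral_right_triangle_symmetric[OF h cont(3,4)])
  also have "integral {0..h} (\<lambda>t. (pi / h)\<^sup>2 * (sin (pi / h * t))\<^sup>2) = (pi / h)\<^sup>2 * (h / 2)"
    by (simp only: Henstock_Kurzweil_Integration.integral_mult_right integral_cos_period(3)[OF h])
  finally show "(L2_norm ?L (grad (extremal h)))\<^sup>2 = pi\<^sup>2 / 2"
    using h by (simp add: power_divide power2_eq_square)
qed

lemma L2_tendsto_const: "L2_tendsto M (\<lambda>n. f) f"
  by (simp add: L2_tendsto_def L2_def L2_norm_def)

text \<open>
  A smooth function is the constant approximating sequence of its own trace.  The integrals over the
  two legs are \<open>- h\<close> and \<open>h\<close>.
\<close>

lemma extremal_in_H1_mean_zero:
  assumes h: "0 < h"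
  shows "(extremal h, grad (extremal h)) \<in> H1_mean_zero (right_triangle h) (legs h)"
proof -
  let ?w = "extremal h" and ?L = "lebesgue_on (right_triangle h)"
  let ?F = "restrict_space arc_length (frontier (right_triangle h))"
  interpret F: finite_measure ?F by (rule finite_measure_frontier[OF h])
  have grad: "grad ?w = (\<lambda>p. (- (pi / h) * sin (pi / h * fst p), - (pi / h) * sin (pi / h * snd p)))"
    by (rule ext) (rule grad_extremal)
  have cont: "continuous_on UNIV ?w" "continuous_on UNIV (grad ?w)"
    unfolding grad unfolding extremal_def by (intro continuous_intros)+
  have "?w \<in> L2 ?L" "grad ?w \<in> L2 ?L"
    by (intro continuous_L2_lebesgue_on cont bounded_right_triangle borel_right_triangle)+
  moreover have "weak_gradient (right_triangle h) ?w (grad ?w)"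
    by (intro smooth_weak_gradient smooth_extremal bounded_right_triangle borel_right_triangle)
  moreover have "has_trace (right_triangle h) (?w, grad ?w) ?w"
  proof -
    have "?w \<in> L2 ?F"
    proof (rule F.L2_bounded)
      show "?w \<in> borel_measurable ?F"
        by (intro measurable_restrict_space1 borel_measurable_hausdorff borel_measurable_continuous_onI cont)
      have "\<bar>cos a + cos b\<bar> \<le> 2" for a b :: real
        using abs_cos_le_one[of a] abs_cos_le_one[of b] by linarith
      then show "norm (?w p) \<le> 2" for p by (simp add: extremal_def)
    qed
    then show ?thesis
      unfolding has_trace_def using smooth_extremal by (auto intro!: L2_tendsto_const exI[of _ "\<lambda>n. ?w"])
  qed
  moreover have "mean_value (legs h) ?w = 0"
  proof -
    have c: "((\<lambda>t. cos (pi / h * t)) has_integral 0) {0..h}"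
      by (rule has_integral_eq_rhs[OF _ integral_cos_period(1)[OF h, symmetric]])
        (intro integrable_integral integrable_continuous_real continuous_intros)
    have const: "((\<lambda>t. c) has_integral h * c) {0..h}" for c :: real
      using has_integral_const_real[of c 0 h] h by simp
    have "integral {0..h} (\<lambda>t. ?w (h, t)) = - h" "integral {0..h} (\<lambda>t. ?w (t, 0)) = h"
      using has_integral_add[OF const[of "- 1"] c] has_integral_add[OF c const[of 1]] h
      by (simp_all add: extremal_def has_integral_iff)
    then show ?thesis by (simp add: mean_value_def set_integral_legs(1)[OF h cont(1)])
  qed
  ultimately show ?thesis by (auto simp: H1_mean_zero_def H1_def)
qed

theorem theorem3p3:
  fixes h :: real and \<Omega> \<Gamma> :: "(real \<times> real) set"
  assumes "h > 0"
    and "\<Omega> = {(x1, x2). 0 < x2 \<and> x2 < x1 \<and> x1 < h}"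
    and "\<Gamma> = {(x1, x2). x1 = h \<and> x2 \<in> {0..h}} \<union> {(x1, x2). x2 = 0 \<and> x1 \<in> {0..h}}"
  shows "is_sharp_constant \<Omega> \<Gamma> (h / pi)"
proof -
  have eq: "\<Omega> = right_triangle h" "\<Gamma> = legs h"
    unfolding assms(2,3) right_triangle_def legs_def by simp_all
  have "h / pi \<le> C" if "poincare_bound (right_triangle h) (legs h) C" for C
  proof -
    let ?L = "lebesgue_on (right_triangle h)"
    have "L2_norm ?L (extremal h) = h / sqrt 2"
      by (rule power2_eq_imp_eq)
         (use assms(1) in \<open>simp_all add: L2_norm_extremal L2_norm_nonneg power_divide\<close>)
    moreover have "L2_norm ?L (grad (extremal h)) = pi / sqrt 2"
      by (rule power2_eq_imp_eq)
         (use assms(1) in \<open>simp_all add: L2_norm_extremal L2_norm_nonneg power_divide\<close>)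
    moreover have "L2_norm ?L (extremal h) \<le> C * L2_norm ?L (grad (extremal h))"
      using that extremal_in_H1_mean_zero[OF assms(1)] by (auto simp: poincare_bound_def)
    ultimately have "h / sqrt 2 \<le> (C * pi) / sqrt 2" by simp
    then have "h \<le> C * pi" by (simp add: divide_le_cancel)
    then show ?thesis by (simp add: divide_le_eq)
  qed
  with poincare_bound_right_triangle[OF assms(1)] show ?thesis
    unfolding is_sharp_constant_def eq by blast
qed

end
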